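(* Let $f:\mathbb{R}^d\to[0,\infty)$ be continuous, log-concave and symmetric ($f(-x)=f(x)$). Let $\Sigma$ be a $d\times d$ symmetric positive definite matrix and $\varphi:[0,\infty)\to[0,\infty)$ a continuous non-increasing function. Then $$\int_{\mathbb{R}^d} f(x)\,\varphi(\langle\Sigma x,x\rangle)\,\mathrm{d}\gamma_d(x)\ \ge\ \Big(\int_{\mathbb{R}^d} f\,\mathrm{d}\gamma_d\Big)\Big(\int_{\mathbb{R}^d}\varphi(\langle\Sigma x,x\rangle)\,\mathrm{d}\gamma_d(x)\Big).$$
   Context: $\gamma_d$ is the standard Gaussian measure on $\mathbb{R}^d$. A function $f\ge0$ is log-concave if $f(\lambda x+(1-\lambda)y)\ge f(x)^\lambda f(y)^{1-\lambda}$ for all $x,y\in\mathbb{R}^d$ and $\lambda\in(0,1)$. *)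

theory Defs
  imports "HOL-Analysis.Analysis"
begin

definition log_concave :: "('a::real_vector \<Rightarrow> real) \<Rightarrow> bool" where
  "log_concave f \<longleftrightarrow> (\<forall>x. f x \<ge> 0) \<and>
     (\<forall>x y. \<forall>t::real. 0 < t \<and> t < 1 \<longrightarrow>
        f (t *\<^sub>R x + (1 - t) *\<^sub>R y) \<ge> f x powr t * f y powr (1 - t))"

definition std_gaussian :: "(real ^ 'n) measure" where
  "std_gaussian = density lborel
     (\<lambda>x. ennreal ((2 * pi) powr (- real CARD('n) / 2) * exp (- (norm x)\<^sup>2 / 2)))"

end

(*
Work in an orthonormal eigenbasis of Sigma and let A(t) = exp(-t Sigma^(-1)),
B(t) = sqrt(1 - A(t)^2). For independent standard Gaussian vectors X, Z the function
E f(X) phi(q(A(t) X + B(t) Z)), with q the quadratic form of Sigma, tends to the left-hand side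
as t -> 0 and to the product of the two integrals as t -> infinity, so it suffices that it is
nonincreasing. With (Y, W) the rotated pair, its derivative is
  E 2 phi'(q(Y)) f(A Y - B W) <A B^(-1) Y, W>,
because Sigma in the gradient of q cancels against the speed Sigma^(-1) of the flow. As phi' <= 0,
one needs E f(B (a - W)) <a, W> >= 0 for every a. Averaging over the directions orthogonal to a
leaves an even log-concave function of one real variable (Prekopa), for which this is clear.
Prekopa's theorem is only needed for one-dimensional Gaussian averages, applied one coordinate
at a time, and no regularity of f beyond continuity enters; phi is smoothed at the end.
*)

theory Submission
  imports Defs "HOL-Probability.Distributions"
begin

section \<open>The standard Gaussian measure and its rotations\<close>

text \<open>The speed 1/l along each eigenvector is what makes the sign argument possible. With one
  common speed the weights of Sigma would survive, and the derivative would contain <Sigma a, W>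
  next to f(B (a - W)), where a = A B^(-1) Y; averaging over the directions orthogonal to the shift
  needs the inner product with the shift a itself. The derivative is used only for t > 0, since
  B(t)^(-1) blows up as t tends to 0. Both ends of the interpolation are therefore reached as limits
  along sequences. Rotation invariance and Fubini in a chosen direction come from one device: a
  rotation is a product of shears, a shear is a translation on every fibre, and the Gaussian density
  depends on the norm only. Prekopa's inequality on the line reduces, once both functions have
  supremum 1, to a statement about lengths of intervals, applied level by level. The smoothing
  replaces phi by its mean over [r, r + h], which is nonincreasing and continuously
  differentiable.\<close>

definition gaussian :: "'a::euclidean_space measure" where
  "gaussian = density lborel
     (\<lambda>x. ennreal ((2 * pi) powr (- real DIM('a) / 2) * exp (- (norm x)\<^sup>2 / 2)))"

text \<open>The proof also uses Gaussians on \<open>real\<close>, on \<open>'a \<times> real\<close>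
  and on \<open>'a \<times> 'a\<close>; \<open>gaussian\<close> treats all of them with one
  definition.\<close>

lemma std_gaussian_eq_gaussian: "(std_gaussian :: (real ^ 'n) measure) = gaussian"
  by (simp add: std_gaussian_def gaussian_def)

lemma sets_gaussian [simp, measurable_cong]: "sets gaussian = sets borel"
  by (simp add: gaussian_def)

lemma space_gaussian [simp]: "space gaussian = UNIV"
  by (simp add: gaussian_def)

lemma measurable_gaussian1 [simp]: "measurable gaussian M = measurable borel M"
  and measurable_gaussian2 [simp]: "measurable M gaussian = measurable M borel"
  by (auto intro!: measurable_cong_sets)

lemma norm2_eq_sum_Basis:
  fixes x :: "'a::euclidean_space"
  shows "(norm x)\<^sup>2 = (\<Sum>b\<in>Basis. (x \<bullet> b)\<^sup>2)"
  unfolding power2_norm_eq_inner by (subst euclidean_inner) (simp add: power2_eq_square)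

lemma gaussian_density_prod:
  fixes x :: "'a::euclidean_space"
  shows "(2 * pi) powr (- real DIM('a) / 2) * exp (- (norm x)\<^sup>2 / 2)
           = (\<Prod>b\<in>Basis. std_normal_density (x \<bullet> b))"
proof -
  have "(\<Prod>b\<in>Basis. std_normal_density (x \<bullet> b))
          = (1 / sqrt (2 * pi)) ^ DIM('a) * exp (\<Sum>b\<in>Basis. - (x \<bullet> b)\<^sup>2 / 2)"
    by (simp only: std_normal_density_def prod.distrib prod_constant exp_sum finite_Basis)
  also have "(\<Sum>b\<in>Basis. - (x \<bullet> b)\<^sup>2 / 2) = - (norm x)\<^sup>2 / 2"
    by (simp add: norm2_eq_sum_Basis sum_negf flip: sum_divide_distrib)
  also have "(1 / sqrt (2 * pi)) ^ DIM('a) = ((2 * pi) powr (- (1/2))) ^ DIM('a)"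
    by (simp add: powr_minus_divide powr_half_sqrt)
  also have "\<dots> = (2 * pi) powr (- real DIM('a) / 2)"
    by (subst powr_realpow[symmetric]) (auto simp: powr_powr)
  finally show ?thesis by simp
qed

lemma prob_space_gaussian: "prob_space (gaussian :: 'a::euclidean_space measure)"
proof
  have "(\<integral>\<^sup>+x. ennreal (std_normal_density x) \<partial>lborel) = 1"
    using prob_space.emeasure_space_1[OF prob_space_normal_density[of 1 0]]
    by (simp add: emeasure_density)
  moreover have "emeasure (gaussian :: 'a measure) UNIV
      = (\<integral>\<^sup>+x. (\<Prod>b\<in>Basis. ennreal (std_normal_density (x \<bullet> b))) \<partial>(lborel :: 'a measure))"
    by (simp add: gaussian_def emeasure_density prod_ennreal flip: gaussian_density_prod)
  moreover have "\<dots> = (\<Prod>b\<in>(Basis :: 'a set). \<integral>\<^sup>+x. ennreal (std_normal_density x) \<partial>lborel)"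
    by (rule nn_integral_lborel_prod) auto
  ultimately show "emeasure (gaussian :: 'a measure) (space gaussian) = 1"
    by simp
qed

interpretation gaussian: prob_space gaussian
  by (rule prob_space_gaussian)

interpretation gaussian_pair: pair_prob_space gaussian gaussian ..

text \<open>Squared norms add on pairs, so the densities multiply. An independent pair of Gaussian
  vectors is thus one Gaussian vector, to which the rotation lemmas apply.\<close>

lemma gaussian_prod:
  "gaussian \<Otimes>\<^sub>M gaussian = (gaussian :: ('a::euclidean_space \<times> 'b::euclidean_space) measure)"
proof -
  have "sigma_finite_measure (density (lborel :: 'b measure)
     (\<lambda>x. ennreal ((2 * pi) powr (- real DIM('b) / 2) * exp (- (norm x)\<^sup>2 / 2))))"
    using gaussian.sigma_finite_measure_axioms[where ?'a = 'b] by (simp add: gaussian_def)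
  then have "(gaussian :: 'a measure) \<Otimes>\<^sub>M (gaussian :: 'b measure) = density (lborel \<Otimes>\<^sub>M lborel)
     (\<lambda>(x, y). ennreal ((2 * pi) powr (- real DIM('a) / 2) * exp (- (norm x)\<^sup>2 / 2))
        * ennreal ((2 * pi) powr (- real DIM('b) / 2) * exp (- (norm y)\<^sup>2 / 2)))"
    unfolding gaussian_def by (intro pair_measure_density) (auto intro: lborel.sigma_finite_measure_axioms)
  also have "\<dots> = gaussian"
    unfolding gaussian_def lborel_prod
  proof (intro density_cong)
    have "ennreal ((2 * pi) powr (- real DIM('a) / 2) * exp (- (norm x)\<^sup>2 / 2))
        * ennreal ((2 * pi) powr (- real DIM('b) / 2) * exp (- (norm y)\<^sup>2 / 2))
       = ennreal ((2 * pi) powr (- real DIM('a \<times> 'b) / 2) * exp (- (norm (x, y))\<^sup>2 / 2))" for x :: 'a and y :: 'b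
    proof -
      have "(2 * pi) powr (- real DIM('a \<times> 'b) / 2) = (2 * pi) powr (- real DIM('a) / 2) * (2 * pi) powr (- real DIM('b) / 2)"
        by (subst powr_add[symmetric]) (simp add: field_simps)
      moreover have "exp (- (norm (x, y))\<^sup>2 / 2) = exp (- (norm x)\<^sup>2 / 2) * exp (- (norm y)\<^sup>2 / 2)"
        by (subst exp_add[symmetric]) (simp add: norm_Pair field_simps)
      ultimately show ?thesis
        by (simp only: mult_ac flip: ennreal_mult')  (simp add: mult_ac flip: ennreal_mult')
    qed
    then show "AE x in lborel. (case x of (x::'a, y::'b) \<Rightarrow>
        ennreal ((2 * pi) powr (- real DIM('a) / 2) * exp (- (norm x)\<^sup>2 / 2))
        * ennreal ((2 * pi) powr (- real DIM('b) / 2) * exp (- (norm y)\<^sup>2 / 2)))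
       = ennreal ((2 * pi) powr (- real DIM('a \<times> 'b) / 2) * exp (- (norm x)\<^sup>2 / 2))"
      by (intro AE_I2) (simp only: case_prod_unfold prod.collapse)
    show "(\<lambda>(x::'a, y::'b). ennreal ((2 * pi) powr (- real DIM('a) / 2) * exp (- (norm x)\<^sup>2 / 2))
        * ennreal ((2 * pi) powr (- real DIM('b) / 2) * exp (- (norm y)\<^sup>2 / 2))) \<in> borel_measurable lborel"
      unfolding measurable_lborel2 borel_prod[symmetric] case_prod_unfold by measurable
    show "(\<lambda>x::'a \<times> 'b. ennreal ((2 * pi) powr (- real DIM('a \<times> 'b) / 2) * exp (- (norm x)\<^sup>2 / 2))) \<in> borel_measurable lborel"
      unfolding measurable_lborel2 by measurable
  qed
  finally show ?thesis .
qed

text \<open>The density is a function of the norm alone, so composing it with \<open>R\<close>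
  changes nothing, and the invariance of Lebesgue measure carries over.\<close>

lemma distr_gaussian_preserving:
  fixes R :: "'a::euclidean_space \<Rightarrow> 'a"
  assumes [measurable]: "R \<in> borel_measurable borel"
    and R: "distr lborel borel R = lborel" and n: "\<And>x. norm (R x) = norm x"
  shows "distr gaussian borel R = gaussian"
proof -
  let ?p = "\<lambda>x::'a. ennreal ((2 * pi) powr (- real DIM('a) / 2) * exp (- (norm x)\<^sup>2 / 2))"
  have "gaussian = density (distr lborel borel R) ?p"
    by (simp add: R gaussian_def)
  also have "\<dots> = distr (density lborel (\<lambda>x. ?p (R x))) borel R"
    by (rule density_distr) auto
  also have "\<dots> = distr gaussian borel R"
    by (simp add: n gaussian_def)
  finally show ?thesis by simp
qed

section \<open>Shears, and rotations as products of shears\<close>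

lemma nn_integral_lborel_translate:
  fixes g :: "'a::euclidean_space \<Rightarrow> ennreal"
  assumes [measurable]: "g \<in> borel_measurable borel"
  shows "(\<integral>\<^sup>+x. g (x + c) \<partial>lborel) = (\<integral>\<^sup>+x. g x \<partial>lborel)"
  by (subst (2) lborel_distr_plus[of c, symmetric]) (simp add: nn_integral_distr add.commute)

text \<open>On each fibre with one component fixed, a shear is a translation; Tonelli assembles the
  fibres. Both versions are needed because a rotation alternates them.\<close>

lemma lborel_distr_shear:
  fixes T :: "'b::euclidean_space \<Rightarrow> 'a::euclidean_space"
  assumes [measurable]: "T \<in> borel_measurable borel"
  shows "distr lborel borel (\<lambda>w. (fst w + T (snd w), snd w)) = lborel"
    and "distr lborel borel (\<lambda>w. (fst w, snd w + T (fst w))) = lborel"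
proof -
  show "distr lborel borel (\<lambda>w. (fst w + T (snd w), snd w)) = lborel"
  proof (rule measure_eqI)
    fix A :: "('a \<times> 'b) set" assume "A \<in> sets (distr lborel borel (\<lambda>w. (fst w + T (snd w), snd w)))"
    then have [measurable]: "A \<in> sets borel" by simp
    have [measurable]: "(\<lambda>w::'a\<times>'b. (fst w + T (snd w), snd w)) \<in> borel \<rightarrow>\<^sub>M borel"
      by (simp add: borel_prod[symmetric])
    have [measurable]: "A \<in> sets (borel \<Otimes>\<^sub>M borel)"
      using \<open>A \<in> sets borel\<close> by (simp only: borel_prod)
    have "emeasure (distr lborel borel (\<lambda>w. (fst w + T (snd w), snd w))) A
        = (\<integral>\<^sup>+w. indicator A (fst w + T (snd w), snd w) \<partial>(lborel \<Otimes>\<^sub>M lborel))"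
      by (simp add: lborel_prod flip: nn_integral_indicator) (subst nn_integral_distr; simp)
    also have "\<dots> = (\<integral>\<^sup>+y. \<integral>\<^sup>+x. indicator A (x + T y, y) \<partial>lborel \<partial>lborel)"
      by (subst lborel_pair.nn_integral_snd[symmetric]) auto
    also have "\<dots> = (\<integral>\<^sup>+y. \<integral>\<^sup>+x. indicator A (x, y) \<partial>lborel \<partial>lborel)"
      by (subst nn_integral_lborel_translate[where g="\<lambda>x. indicator A (x, _)"]) auto
    also have "\<dots> = (\<integral>\<^sup>+w. indicator A w \<partial>(lborel \<Otimes>\<^sub>M lborel))"
      by (subst lborel_pair.nn_integral_snd[symmetric]) auto
    finally show "emeasure (distr lborel borel (\<lambda>w. (fst w + T (snd w), snd w))) A = emeasure lborel A"
      by (simp add: lborel_prod)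
  qed simp
  show "distr lborel borel (\<lambda>w. (fst w, snd w + T (fst w))) = lborel"
  proof (rule measure_eqI)
    fix A :: "('b \<times> 'a) set" assume "A \<in> sets (distr lborel borel (\<lambda>w. (fst w, snd w + T (fst w))))"
    then have [measurable]: "A \<in> sets borel" by simp
    have [measurable]: "(\<lambda>w::'b\<times>'a. (fst w, snd w + T (fst w))) \<in> borel \<rightarrow>\<^sub>M borel"
      by (simp add: borel_prod[symmetric])
    have [measurable]: "A \<in> sets (borel \<Otimes>\<^sub>M borel)"
      using \<open>A \<in> sets borel\<close> by (simp only: borel_prod)
    have "emeasure (distr lborel borel (\<lambda>w. (fst w, snd w + T (fst w)))) A
        = (\<integral>\<^sup>+w. indicator A (fst w, snd w + T (fst w)) \<partial>(lborel \<Otimes>\<^sub>M lborel))"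
      by (simp add: lborel_prod flip: nn_integral_indicator) (subst nn_integral_distr; simp)
    also have "\<dots> = (\<integral>\<^sup>+x. \<integral>\<^sup>+y. indicator A (x, y + T x) \<partial>lborel \<partial>lborel)"
      by (subst lborel.nn_integral_fst[symmetric]) auto
    also have "\<dots> = (\<integral>\<^sup>+x. \<integral>\<^sup>+y. indicator A (x, y) \<partial>lborel \<partial>lborel)"
      by (subst nn_integral_lborel_translate[where g="\<lambda>y. indicator A (_, y)"]) auto
    also have "\<dots> = (\<integral>\<^sup>+w. indicator A w \<partial>(lborel \<Otimes>\<^sub>M lborel))"
      by (subst lborel.nn_integral_fst[symmetric]) auto
    finally show "emeasure (distr lborel borel (\<lambda>w. (fst w, snd w + T (fst w)))) A = emeasure lborel A"
      by (simp add: lborel_prod)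
  qed simp
qed

text \<open>A rotation with cosine C and sine S is a product of three shears, where \<open>T = (1 - C) / S\<close>.\<close>

lemma distr_gaussian_rotation:
  fixes T :: "'b::euclidean_space \<Rightarrow> 'a::euclidean_space" and S :: "'a \<Rightarrow> 'b"
    and R :: "'a \<times> 'b \<Rightarrow> 'a \<times> 'b"
  assumes [measurable]: "T \<in> borel_measurable borel" "S \<in> borel_measurable borel"
    and R: "\<And>x z. R (x, z) = (let x1 = x + T z; z1 = z - S x1 in (x1 + T z1, z1))"
    and n: "\<And>w. norm (R w) = norm w"
  shows "distr gaussian borel R = gaussian"
proof -
  let ?A = "\<lambda>w. (fst w + T (snd w), snd w)" and ?B = "\<lambda>w. (fst w, snd w + (- S (fst w)))"
  have [measurable]: "?A \<in> borel \<rightarrow>\<^sub>M borel" "?B \<in> borel \<rightarrow>\<^sub>M borel"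
    by (simp_all add: borel_prod[symmetric])
  have Req: "R = ?A \<circ> (?B \<circ> ?A)"
    by (auto simp: fun_eq_iff R Let_def)
  have [measurable]: "R \<in> borel \<rightarrow>\<^sub>M borel"
    unfolding Req by measurable
  have "distr lborel borel R = distr (distr (distr lborel borel ?A) borel ?B) borel ?A"
    unfolding Req by (subst distr_distr, measurable)+ (simp add: comp_assoc)
  also have "\<dots> = lborel"
    using lborel_distr_shear(1)[of T] lborel_distr_shear(2)[of "\<lambda>x. - S x"] by simp
  finally show ?thesis
    by (intro distr_gaussian_preserving n) auto
qed

section \<open>Resampling one Gaussian coordinate, and second moments\<close>

lemma integral_gaussian_distr:
  fixes F :: "'b::euclidean_space \<Rightarrow> real"
  assumes "distr (gaussian :: 'a::euclidean_space measure) borel R = gaussian" "R \<in> borel_measurable borel"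
    "F \<in> borel_measurable borel"
  shows "(\<integral>x. F (R x) \<partial>gaussian) = (\<integral>x. F x \<partial>gaussian)"
    and "integrable gaussian (\<lambda>x. F (R x)) \<longleftrightarrow> integrable gaussian F"
  using integral_distr[of R gaussian borel F] integrable_distr_eq[of R gaussian borel F] assms by auto

lemma distr_gaussian_fst:
  "distr (gaussian :: ('a::euclidean_space \<times> 'b::euclidean_space) measure) borel fst = gaussian"
proof -
  have "distr (gaussian \<Otimes>\<^sub>M (gaussian :: 'b measure)) gaussian fst = (gaussian :: 'a measure)"
    by (rule gaussian.distr_pair_fst)
  moreover have "distr (gaussian \<Otimes>\<^sub>M (gaussian :: 'b measure)) gaussian fst
     = distr (gaussian \<Otimes>\<^sub>M (gaussian :: 'b measure)) borel (fst :: 'a \<times> 'b \<Rightarrow> 'a)"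
    by (rule distr_cong) auto
  ultimately show ?thesis by (simp add: gaussian_prod)
qed

lemma distr_gaussian_uminus: "distr gaussian borel uminus = (gaussian :: real measure)"
  by (rule distr_gaussian_preserving) (auto simp: lborel_distr_uminus)

text \<open>A quarter turn in the plane spanned by \<open>e\<close> and the additional real axis:
  the cosine is 0 and the sine is 1, so \<open>(1 - C) / S\<close> is 1 and all three shears have
  unit slope.\<close>

lemma distr_gaussian_swap:
  fixes e :: "'a::euclidean_space"
  assumes e: "norm e = 1"
  shows "distr gaussian borel (\<lambda>w::'a \<times> real. (fst w - (fst w \<bullet> e) *\<^sub>R e + snd w *\<^sub>R e, - (fst w \<bullet> e))) = gaussian"
proof (rule distr_gaussian_rotation[where T="\<lambda>s. s *\<^sub>R e" and S="\<lambda>x. x \<bullet> e"])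
  have ee: "e \<bullet> e = 1" using e by (simp add: norm_eq_1)
  show "norm (fst w - (fst w \<bullet> e) *\<^sub>R e + snd w *\<^sub>R e, - (fst w \<bullet> e)) = norm w" for w :: "'a \<times> real"
  proof -
    define c where "c = snd w - fst w \<bullet> e"
    have "fst w - (fst w \<bullet> e) *\<^sub>R e + snd w *\<^sub>R e = fst w + c *\<^sub>R e"
      by (simp add: c_def algebra_simps)
    moreover have "(norm (fst w + c *\<^sub>R e))\<^sup>2 = (norm (fst w))\<^sup>2 + 2 * c * (fst w \<bullet> e) + c\<^sup>2"
      using dot_norm[of "fst w" "c *\<^sub>R e"] e by simp
    then have "(norm (fst w + c *\<^sub>R e))\<^sup>2 + (fst w \<bullet> e)\<^sup>2 = (norm (fst w))\<^sup>2 + (snd w)\<^sup>2"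
      by (simp add: c_def power2_eq_square algebra_simps)
    ultimately show ?thesis by (simp only: norm_Pair norm_prod_def[of w]) simp
  qed
  show "(fst (x, z) - (fst (x, z) \<bullet> e) *\<^sub>R e + snd (x, z) *\<^sub>R e, - (fst (x, z) \<bullet> e)) =
       (let x1 = x + z *\<^sub>R e; z1 = z - x1 \<bullet> e in (x1 + z1 *\<^sub>R e, z1))" for x z
    by (simp add: Let_def inner_simps ee algebra_simps)
qed auto

lemma distr_gaussian_resample:
  fixes e :: "'a::euclidean_space"
  assumes e: "norm e = 1"
  shows "distr gaussian borel (\<lambda>w::'a \<times> real. fst w - (fst w \<bullet> e) *\<^sub>R e + snd w *\<^sub>R e) = gaussian"
proof -
  let ?R = "\<lambda>w::'a \<times> real. (fst w - (fst w \<bullet> e) *\<^sub>R e + snd w *\<^sub>R e, - (fst w \<bullet> e))"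
  have [measurable]: "?R \<in> borel \<rightarrow>\<^sub>M borel"
    by (simp add: borel_prod[symmetric])
  have "gaussian = distr (distr gaussian borel ?R) borel (fst :: 'a \<times> real \<Rightarrow> 'a)"
    by (simp add: distr_gaussian_swap[OF e] distr_gaussian_fst)
  also have "\<dots> = distr gaussian borel (fst \<circ> ?R)"
    by (rule distr_distr) (auto simp: borel_prod[symmetric])
  finally show ?thesis by (simp add: comp_def)
qed

text \<open>Fubini in the direction \<open>e\<close> without a measure on the orthogonal complement:
  the projected \<open>u\<close> has lost its coordinate along \<open>e\<close>, and
  \<open>s\<close> supplies a fresh independent one.\<close>

lemma integral_gaussian_resample:
  fixes e :: "'a::euclidean_space" and F :: "'a \<Rightarrow> real"
  assumes e: "norm e = 1" and F: "integrable gaussian F"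
  shows "(\<integral>x. F x \<partial>gaussian) = (\<integral>s. \<integral>u. F (u - (u \<bullet> e) *\<^sub>R e + s *\<^sub>R e) \<partial>gaussian \<partial>(gaussian :: real measure))"
proof -
  let ?P = "\<lambda>w::'a \<times> real. fst w - (fst w \<bullet> e) *\<^sub>R e + snd w *\<^sub>R e"
  have [measurable]: "?P \<in> borel \<rightarrow>\<^sub>M borel" "F \<in> borel_measurable borel"
    using F by (simp_all add: borel_prod[symmetric] borel_measurable_integrable)
  have "integrable gaussian (\<lambda>w. F (?P w))"
    using F by (subst integral_gaussian_distr(2)[OF distr_gaussian_resample[OF e]]) auto
  then have "integrable (gaussian \<Otimes>\<^sub>M gaussian) (\<lambda>(u, s). F (?P (u, s)))"
    by (simp add: gaussian_prod case_prod_unfold)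
  then have "(\<integral>w. F (?P w) \<partial>(gaussian \<Otimes>\<^sub>M gaussian)) = (\<integral>s. \<integral>u. F (?P (u, s)) \<partial>gaussian \<partial>gaussian)"
    using gaussian_pair.integral_snd[of "\<lambda>u s. F (?P (u, s))"] by (simp add: case_prod_unfold)
  then show ?thesis
    using integral_gaussian_distr(1)[OF distr_gaussian_resample[OF e], of F] by (simp add: gaussian_prod)
qed

lemma gaussian_real_eq: "(gaussian :: real measure) = density lborel std_normal_density"
  by (simp add: gaussian_def std_normal_density_def powr_minus_divide powr_half_sqrt)

text \<open>The time derivative of the interpolation and the drift integrands grow at most
  quadratically, so this is the moment that dominates them.\<close>

lemma integrable_gaussian_norm2: "integrable (gaussian :: 'a::euclidean_space measure) (\<lambda>x. (norm x)\<^sup>2)"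
proof -
  have 1: "integrable (gaussian :: real measure) (\<lambda>s. s\<^sup>2)"
    using integrable_std_normal_moment[of 2]
    by (simp only: gaussian_real_eq) (subst integrable_density; simp)
  have "integrable (gaussian :: 'a measure) (\<lambda>x. (x \<bullet> b)\<^sup>2)" if b: "b \<in> Basis" for b
  proof -
    have nb: "norm b = 1" "b \<bullet> b = 1" using b by auto
    have [measurable]: "(\<lambda>w::'a \<times> real. fst w - (fst w \<bullet> b) *\<^sub>R b + snd w *\<^sub>R b) \<in> borel \<rightarrow>\<^sub>M borel"
      by (simp add: borel_prod[symmetric])
    have "integrable (gaussian :: (real \<times> 'a) measure) (\<lambda>w. (fst w)\<^sup>2)"
      by (subst integral_gaussian_distr(2)[OF distr_gaussian_fst, of "\<lambda>s::real. s\<^sup>2"])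
         (simp_all add: 1 borel_prod[symmetric])
    then have "integrable (gaussian \<Otimes>\<^sub>M (gaussian::'a measure)) (\<lambda>w. (fst w :: real)\<^sup>2)"
      by (simp add: gaussian_prod)
    then have "integrable ((gaussian::'a measure) \<Otimes>\<^sub>M gaussian) (\<lambda>w. (snd w :: real)\<^sup>2)"
      by (subst gaussian_pair.integrable_product_swap_iff[symmetric]) (simp add: case_prod_unfold)
    \<comment> \<open>The \<open>b\<close>-coordinate of the resampled vector is exactly
      \<open>snd w\<close>, which reduces the claim to the second moment on the line.\<close>
    then have "integrable (gaussian :: ('a \<times> real) measure)
       (\<lambda>w. ((fst w - (fst w \<bullet> b) *\<^sub>R b + snd w *\<^sub>R b) \<bullet> b)\<^sup>2)"
      by (simp add: inner_simps nb gaussian_prod)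
    then show ?thesis
      using integral_gaussian_distr(2)[OF distr_gaussian_resample[OF nb(1)], of "\<lambda>x. (x \<bullet> b)\<^sup>2"] by simp
  qed
  then have "integrable (gaussian :: 'a measure) (\<lambda>x. \<Sum>b\<in>Basis. (x \<bullet> b)\<^sup>2)"
    by auto
  then show ?thesis
    by (simp add: norm2_eq_sum_Basis)
qed

section \<open>The one-dimensional Prekopa-Leindler inequality\<close>

text \<open>One-dimensional Brunn-Minkowski for intervals: every point strictly between the weighted
  infima and the weighted suprema is a weighted combination of a point of \<open>A\<close> and a
  point of \<open>B\<close>.\<close>

lemma weighted_length_le_emeasure:
  fixes A B H :: "real set"
  assumes A: "convex A" "bounded A" "A \<noteq> {}" and B: "convex B" "bounded B" "B \<noteq> {}"
    and t: "0 < t" "t < 1" and H [measurable]: "H \<in> sets borel"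
    and AB: "\<And>a b. a \<in> A \<Longrightarrow> b \<in> B \<Longrightarrow> t * a + (1 - t) * b \<in> H"
  shows "ennreal t * emeasure lborel A + ennreal (1 - t) * emeasure lborel B \<le> emeasure lborel H"
proof -
  let ?l = "t * Inf A + (1 - t) * Inf B" and ?u = "t * Sup A + (1 - t) * Sup B"
  have bdd: "bdd_below A" "bdd_above A" "bdd_below B" "bdd_above B"
    using A B bounded_imp_bdd_below bounded_imp_bdd_above by auto
  have len: "emeasure lborel C \<le> ennreal (Sup C - Inf C)" if "bounded C" for C :: "real set"
  proof (cases "C = {}")
    case False
    have "C \<subseteq> {Inf C..Sup C}"
      using bounded_imp_bdd_below[OF that] bounded_imp_bdd_above[OF that] by (auto intro: cInf_lower cSup_upper)
    then have "emeasure lborel C \<le> emeasure lborel {Inf C..Sup C}"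
      by (intro emeasure_mono) auto
    then show ?thesis
      using False that
      by (simp add: cInf_le_cSup bounded_imp_bdd_below bounded_imp_bdd_above)
  qed simp
  have "{?l<..<?u} \<subseteq> H"
  proof
    fix c assume c: "c \<in> {?l<..<?u}"
    \<comment> \<open>The extremes need not be attained. Points within \<open>e\<close> of the two
      infima have a weighted combination below \<open>?l + e\<close>, which is \<open>c\<close>, as
      the weights add up to 1; \<open>d\<close> plays the same role from above.\<close>
    define e where "e = c - ?l"
    have e: "e > 0" using c by (simp add: e_def)
    obtain a1 where a1: "a1 \<in> A" "a1 < Inf A + e" using cInf_lessD[of A "Inf A + e"] A e by auto
    obtain b1 where b1: "b1 \<in> B" "b1 < Inf B + e" using cInf_lessD[of B "Inf B + e"] B e by auto
    have "t * a1 + (1 - t) * b1 < t * (Inf A + e) + (1 - t) * (Inf B + e)"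
      using a1 b1 t by (intro add_strict_mono mult_strict_left_mono) auto
    then have 1: "t * a1 + (1 - t) * b1 < c" by (simp add: e_def algebra_simps)
    define d where "d = ?u - c"
    have d: "d > 0" using c by (simp add: d_def)
    obtain a2 where a2: "a2 \<in> A" "Sup A - d < a2" using less_cSupD[of A "Sup A - d"] A d by auto
    obtain b2 where b2: "b2 \<in> B" "Sup B - d < b2" using less_cSupD[of B "Sup B - d"] B d by auto
    have "t * (Sup A - d) + (1 - t) * (Sup B - d) < t * a2 + (1 - t) * b2"
      using a2 b2 t by (intro add_strict_mono mult_strict_left_mono) auto
    then have 2: "c < t * a2 + (1 - t) * b2" by (simp add: d_def algebra_simps)
    define m1 where "m1 = t * a1 + (1 - t) * b1"
    define m2 where "m2 = t * a2 + (1 - t) * b2"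
    \<comment> \<open>The same ratio \<open>r\<close> moves both points along their segments, so the
      combination runs linearly from \<open>m1\<close> to \<open>m2\<close> and meets
      \<open>c\<close>.\<close>
    define r where "r = (c - m1) / (m2 - m1)"
    have m: "m1 < c" "c < m2" using 1 2 by (auto simp: m1_def m2_def)
    have r: "0 \<le> r" "r \<le> 1" and rc: "r * (m2 - m1) = c - m1"
      using m by (auto simp: r_def field_simps)
    have "(1 - r) *\<^sub>R a1 + r *\<^sub>R a2 \<in> A" "(1 - r) *\<^sub>R b1 + r *\<^sub>R b2 \<in> B"
      using r convexD[OF A(1) a1(1) a2(1), of "1 - r" r] convexD[OF B(1) b1(1) b2(1), of "1 - r" r] by auto
    from AB[OF this] have "t * ((1 - r) * a1 + r * a2) + (1 - t) * ((1 - r) * b1 + r * b2) \<in> H" by simp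
    also have "t * ((1 - r) * a1 + r * a2) + (1 - t) * ((1 - r) * b1 + r * b2) = m1 + r * (m2 - m1)"
      by (simp add: m1_def m2_def algebra_simps)
    finally show "c \<in> H" using rc by simp
  qed
  then have "emeasure lborel {?l<..<?u} \<le> emeasure lborel H"
    by (intro emeasure_mono) auto
  moreover have "?l \<le> ?u"
    using A B t bdd by (intro add_mono mult_left_mono cInf_le_cSup) auto
  ultimately have "ennreal (?u - ?l) \<le> emeasure lborel H" by simp
  moreover have "ennreal t * emeasure lborel A + ennreal (1 - t) * emeasure lborel B
      \<le> ennreal t * ennreal (Sup A - Inf A) + ennreal (1 - t) * ennreal (Sup B - Inf B)"
    using len A B by (intro add_mono mult_left_mono) auto
  moreover have "\<dots> = ennreal (?u - ?l)"
  proof -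
    have "0 \<le> Sup A - Inf A" "0 \<le> Sup B - Inf B"
      using A B bdd by (simp_all add: cInf_le_cSup)
    moreover have "?u - ?l = t * (Sup A - Inf A) + (1 - t) * (Sup B - Inf B)"
      by (simp add: algebra_simps)
    ultimately show ?thesis using t by (simp add: ennreal_mult)
  qed
  ultimately show ?thesis by simp
qed

text \<open>Tonelli on the region below the graph. The indicator discards the negative levels, at
  which the superlevel set is the whole line.\<close>

lemma nn_integral_layer_cake:
  fixes f :: "real \<Rightarrow> real"
  assumes [measurable]: "f \<in> borel_measurable borel" and f: "\<And>x. 0 \<le> f x"
  shows "(\<integral>\<^sup>+x. ennreal (f x) \<partial>lborel)
      = (\<integral>\<^sup>+r. emeasure lborel {x. r < f x} * indicator {0<..} r \<partial>lborel)"
proof -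
  have "(\<integral>\<^sup>+x. ennreal (f x) \<partial>lborel) = (\<integral>\<^sup>+x. \<integral>\<^sup>+r. indicator {(x, r). 0 < r \<and> r < f x} (x, r) \<partial>lborel \<partial>lborel)"
  proof (rule nn_integral_cong)
    fix x
    have "(\<integral>\<^sup>+r. indicator {(x, r). 0 < r \<and> r < f x} (x, r) \<partial>lborel) = (\<integral>\<^sup>+r. indicator {0<..<f x} r \<partial>lborel)"
      by (intro nn_integral_cong) (auto simp: indicator_def)
    then show "ennreal (f x) = (\<integral>\<^sup>+r. indicator {(x, r). 0 < r \<and> r < f x} (x, r) \<partial>lborel)"
      using f by simp
  qed
  also have "\<dots> = (\<integral>\<^sup>+r. \<integral>\<^sup>+x. indicator {(x, r). 0 < r \<and> r < f x} (x, r) \<partial>lborel \<partial>lborel)"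
    by (rule lborel_pair.Fubini'[symmetric]) measurable
  also have "\<dots> = (\<integral>\<^sup>+r. \<integral>\<^sup>+x. indicator {x. r < f x} x * indicator {0<..} r \<partial>lborel \<partial>lborel)"
    by (intro nn_integral_cong) (auto simp: indicator_def)
  also have "\<dots> = (\<integral>\<^sup>+r. emeasure lborel {x. r < f x} * indicator {0<..} r \<partial>lborel)"
    by (intro nn_integral_cong) (simp add: nn_integral_multc)
  finally show ?thesis .
qed

text \<open>With both suprema equal to 1, the superlevel sets of \<open>f\<close> and
  \<open>g\<close> are nonempty at the same positive levels, those below 1, so the length inequality
  applies at each of them. Integrating over the levels gives an arithmetic mean of the two
  integrals.\<close>

lemma prekopa_leindler_normalized:
  fixes f g h :: "real \<Rightarrow> real"
  assumes [measurable]: "f \<in> borel_measurable borel" "g \<in> borel_measurable borel" "h \<in> borel_measurable borel"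
    and f: "\<And>x. 0 \<le> f x" "\<And>x. f x \<le> 1" "\<And>r. r < 1 \<Longrightarrow> \<exists>x. r < f x"
    and g: "\<And>x. 0 \<le> g x" "\<And>x. g x \<le> 1" "\<And>r. r < 1 \<Longrightarrow> \<exists>x. r < g x"
    and h: "\<And>x. 0 \<le> h x"
    and lev: "\<And>r. 0 < r \<Longrightarrow> convex {x. r < f x}" "\<And>r. 0 < r \<Longrightarrow> bounded {x. r < f x}"
      "\<And>r. 0 < r \<Longrightarrow> convex {x. r < g x}" "\<And>r. 0 < r \<Longrightarrow> bounded {x. r < g x}"
    and t: "0 < t" "t < 1"
    and fgh: "\<And>a b. f a powr t * g b powr (1 - t) \<le> h (t * a + (1 - t) * b)"
  shows "ennreal t * (\<integral>\<^sup>+x. f x \<partial>lborel) + ennreal (1 - t) * (\<integral>\<^sup>+x. g x \<partial>lborel) \<le> (\<integral>\<^sup>+x. h x \<partial>lborel)"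
proof -
  have "ennreal t * (\<integral>\<^sup>+x. f x \<partial>lborel) + ennreal (1 - t) * (\<integral>\<^sup>+x. g x \<partial>lborel)
    = (\<integral>\<^sup>+r. ennreal t * (emeasure lborel {x. r < f x} * indicator {0<..} r)
         + ennreal (1 - t) * (emeasure lborel {x. r < g x} * indicator {0<..} r) \<partial>lborel)"
    using f g by (simp add: nn_integral_layer_cake nn_integral_add nn_integral_cmult)
  also have "\<dots> \<le> (\<integral>\<^sup>+r. emeasure lborel {x. r < h x} * indicator {0<..} r \<partial>lborel)"
  proof (rule nn_integral_mono)
    fix r :: real
    consider "r \<le> 0" | "0 < r" "r < 1" | "1 \<le> r" by linarith
    then show "ennreal t * (emeasure lborel {x. r < f x} * indicator {0<..} r)
         + ennreal (1 - t) * (emeasure lborel {x. r < g x} * indicator {0<..} r)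
        \<le> emeasure lborel {x. r < h x} * indicator {0<..} r"
    proof cases
      case 2
      have "t * a + (1 - t) * b \<in> {x. r < h x}" if "a \<in> {x. r < f x}" "b \<in> {x. r < g x}" for a b
      proof -
        have "r = r powr t * r powr (1 - t)"
          using 2 by (simp add: powr_add[symmetric])
        also have "\<dots> < f a powr t * g b powr (1 - t)"
          using that 2 t by (intro mult_strict_mono powr_less_mono2) auto
        also have "\<dots> \<le> h (t * a + (1 - t) * b)" by (rule fgh)
        finally show ?thesis by simp
      qed
      then have "ennreal t * emeasure lborel {x. r < f x} + ennreal (1 - t) * emeasure lborel {x. r < g x}
          \<le> emeasure lborel {x. r < h x}"
        using 2 f(3)[of r] g(3)[of r] t by (intro weighted_length_le_emeasure lev) auto
      then show ?thesis using 2 by simp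
    next
      case 3
      then have "{x. r < f x} = {}" "{x. r < g x} = {}"
        using f(2) g(2) by (auto simp: not_less intro: order_trans)
      then show ?thesis by simp
    qed simp
  qed
  also have "\<dots> = (\<integral>\<^sup>+x. h x \<partial>lborel)"
    by (simp add: nn_integral_layer_cake h)
  finally show ?thesis .
qed

lemma weighted_am_gm:
  fixes a b t :: real
  assumes "0 \<le> a" "0 \<le> b" "0 < t" "t < 1"
  shows "a powr t * b powr (1 - t) \<le> t * a + (1 - t) * b"
  using Youngs_inequality_0[of t "1 - t" a b] assms by (cases "a = 0 \<or> b = 0") auto

text \<open>Dividing by the suprema reaches the normalized case, and the arithmetic mean obtained
  there dominates the geometric one.\<close>

lemma prekopa_leindler_real:
  fixes f g h :: "real \<Rightarrow> real"
  assumes int: "integrable lborel f" "integrable lborel g" "integrable lborel h"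
    and f: "\<And>x. 0 \<le> f x" "\<And>x. f x \<le> K" and g: "\<And>x. 0 \<le> g x" "\<And>x. g x \<le> K"
    and h: "\<And>x. 0 \<le> h x"
    and lev: "\<And>r. 0 < r \<Longrightarrow> convex {x. r < f x}" "\<And>r. 0 < r \<Longrightarrow> bounded {x. r < f x}"
      "\<And>r. 0 < r \<Longrightarrow> convex {x. r < g x}" "\<And>r. 0 < r \<Longrightarrow> bounded {x. r < g x}"
    and t: "0 < t" "t < 1"
    and fgh: "\<And>a b. f a powr t * g b powr (1 - t) \<le> h (t * a + (1 - t) * b)"
  shows "(\<integral>x. f x \<partial>lborel) powr t * (\<integral>x. g x \<partial>lborel) powr (1 - t) \<le> (\<integral>x. h x \<partial>lborel)"
\<comment> \<open>A function that vanishes identically has supremum 0 and cannot be normalized. Its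
  integral is 0, and a power of 0 is 0, so the left-hand side vanishes.\<close>
proof (cases "(\<forall>x. f x = 0) \<or> (\<forall>x. g x = 0)")
  case True
  then have "(\<integral>x. f x \<partial>lborel) = 0 \<or> (\<integral>x. g x \<partial>lborel) = 0" by auto
  then show ?thesis using h by (auto intro: integral_nonneg_AE)
next
  case False
  have bdd: "bdd_above (range f)" "bdd_above (range g)"
    using f(2) g(2) by (auto intro!: bdd_aboveI[where M=K])
  define F where "F = Sup (range f)"
  define G where "G = Sup (range g)"
  have fF: "f x \<le> F" and gG: "g x \<le> G" for x
    using bdd by (auto simp: F_def G_def intro!: cSup_upper)
  obtain x y where "f x \<noteq> 0" "g y \<noteq> 0" using False by auto
  with fF[of x] gG[of y] f(1)[of x] g(1)[of y] have pos: "F > 0" "G > 0" by auto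
  \<comment> \<open>The divisor of \<open>h\<close> that preserves the hypothesis \<open>fgh\<close>
    when \<open>f\<close> and \<open>g\<close> are divided by \<open>F\<close> and \<open>G\<close>;
    the same factor cancels at the end.\<close>
  define P where "P = F powr t * G powr (1 - t)"
  have P: "P > 0" using pos by (simp add: P_def)
  have conv: "{x. r < k x / c} = {x. r * c < k x}" if "c > 0" for r c :: real and k :: "real \<Rightarrow> real"
    using that by (simp add: pos_less_divide_eq)
  have [measurable]: "f \<in> borel_measurable borel" "g \<in> borel_measurable borel" "h \<in> borel_measurable borel"
    using int by (auto dest: borel_measurable_integrable)
  have ex: "\<exists>x. r < f x / F" "\<exists>x. r < g x / G" if "r < 1" for r
  proof -
    have "r * F < F" "r * G < G" using that pos by auto
    then show "\<exists>x. r < f x / F" "\<exists>x. r < g x / G"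
      using less_cSupD[of "range f" "r * F"] less_cSupD[of "range g" "r * G"] pos
      by (auto simp: F_def[symmetric] G_def[symmetric] pos_less_divide_eq)
  qed
  have "ennreal t * (\<integral>\<^sup>+x. ennreal (f x / F) \<partial>lborel) + ennreal (1 - t) * (\<integral>\<^sup>+x. ennreal (g x / G) \<partial>lborel)
       \<le> (\<integral>\<^sup>+x. ennreal (h x / P) \<partial>lborel)"
  proof (rule prekopa_leindler_normalized)
    fix a b
    have "(f a / F) powr t * (g b / G) powr (1 - t) = (f a powr t * g b powr (1 - t)) / P"
      using f g pos by (simp add: P_def powr_divide)
    then show "(f a / F) powr t * (g b / G) powr (1 - t) \<le> h (t * a + (1 - t) * b) / P"
      using fgh P by (simp add: divide_right_mono)
  qed (use f g h fF gG pos P t ex lev in \<open>auto simp: conv\<close>)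
  then have "ennreal (t * (\<integral>x. f x / F \<partial>lborel) + (1 - t) * (\<integral>x. g x / G \<partial>lborel))
      \<le> ennreal (\<integral>x. h x / P \<partial>lborel)"
    using int f g h pos P t
    by (simp add: nn_integral_eq_integral ennreal_plus integral_nonneg_AE flip: ennreal_mult' times_divide_eq_right)
  moreover have "0 \<le> (\<integral>x. h x / P \<partial>lborel)"
    using h P by (auto intro!: integral_nonneg_AE)
  ultimately have "t * ((\<integral>x. f x \<partial>lborel) / F) + (1 - t) * ((\<integral>x. g x \<partial>lborel) / G) \<le> (\<integral>x. h x \<partial>lborel) / P"
    by (simp add: ennreal_le_iff)
  moreover have nn: "0 \<le> (\<integral>x. f x \<partial>lborel)" "0 \<le> (\<integral>x. g x \<partial>lborel)"
    using f g by (auto intro!: integral_nonneg_AE)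
  ultimately have "((\<integral>x. f x \<partial>lborel) / F) powr t * ((\<integral>x. g x \<partial>lborel) / G) powr (1 - t) \<le> (\<integral>x. h x \<partial>lborel) / P"
    using weighted_am_gm[of "(\<integral>x. f x \<partial>lborel) / F" "(\<integral>x. g x \<partial>lborel) / G" t] t pos by auto
  also have "((\<integral>x. f x \<partial>lborel) / F) powr t * ((\<integral>x. g x \<partial>lborel) / G) powr (1 - t)
     = ((\<integral>x. f x \<partial>lborel) powr t * (\<integral>x. g x \<partial>lborel) powr (1 - t)) / P"
    using nn pos by (simp add: P_def powr_divide)
  finally show ?thesis using P by (simp add: divide_le_cancel)
qed

section \<open>Orthonormal eigenbases and differentiation under the integral\<close>

text \<open>A maximizer \<open>v\<close> of the quadratic form on the unit sphere of
  \<open>S\<close> is a critical point: \<open>T v\<close> is orthogonal to every \<open>w\<close>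
  in \<open>S\<close> that is orthogonal to \<open>v\<close>. For
  \<open>w = T v - m *\<^sub>R v\<close> this makes \<open>w\<close> orthogonal to itself.\<close>

lemma rayleigh_max_eigenvector:
  fixes T :: "'a::euclidean_space \<Rightarrow> 'a"
  assumes T: "linear T" and sym: "\<And>x y. T x \<bullet> y = x \<bullet> T y"
    and S: "subspace S" "S \<noteq> {0}" "\<And>x. x \<in> S \<Longrightarrow> T x \<in> S"
  obtains v where "v \<in> S" "norm v = 1" "T v = (T v \<bullet> v) *\<^sub>R v"
proof -
  have "compact (sphere 0 1 \<inter> S)"
    by (intro compact_Int_closed closed_subspace S) auto
  moreover obtain x where x: "x \<in> S" "x \<noteq> 0"
    using S subspace_0 by blast
  then have "(1 / norm x) *\<^sub>R x \<in> sphere 0 1 \<inter> S"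
    using S by (auto intro: subspace_scale)
  moreover have "continuous_on (sphere 0 1 \<inter> S) (\<lambda>x. T x \<bullet> x)"
    by (intro continuous_intros linear_continuous_on linear_conv_bounded_linear[THEN iffD1] T)
  ultimately obtain v where v: "v \<in> sphere 0 1 \<inter> S" and max: "\<And>y. y \<in> sphere 0 1 \<inter> S \<Longrightarrow> T y \<bullet> y \<le> T v \<bullet> v"
    using continuous_attains_sup[of "sphere 0 1 \<inter> S" "\<lambda>x. T x \<bullet> x"] by blast
  define m where "m = T v \<bullet> v"
  have vv: "v \<bullet> v = 1" "norm v = 1" "v \<in> S" using v by (auto simp: norm_eq_1)
  have le: "T y \<bullet> y \<le> m * (y \<bullet> y)" if y: "y \<in> S" for y
  proof (cases "y = 0")
    case False
    have "T ((1 / norm y) *\<^sub>R y) \<bullet> ((1 / norm y) *\<^sub>R y) \<le> m"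
      unfolding m_def using False y S by (intro max) (auto intro: subspace_scale)
    then show ?thesis
      using False by (simp add: linear_scale[OF T] field_simps dot_square_norm power2_eq_square)
  qed (simp add: linear_0[OF T])
  have orth: "T v \<bullet> w = 0" if w: "w \<in> S" "v \<bullet> w = 0" for w
  proof (rule ccontr)
    assume nz: "T v \<bullet> w \<noteq> 0"
    define c where "c = T v \<bullet> w"
    \<comment> \<open>A positive majorant of the coefficient of \<open>s^2\<close> in the comparison
      at \<open>v + s *\<^sub>R w\<close>. At \<open>s = c / k\<close> the linear term is twice the
      quadratic one, which forces \<open>c = 0\<close>.\<close>
    define k where "k = \<bar>m * (w \<bullet> w) - T w \<bullet> w\<bar> + 1"
    have k: "k > 0" by (simp add: k_def)
    have *: "2 * s * c \<le> s\<^sup>2 * k" for s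
    proof -
      have "T (v + s *\<^sub>R w) \<bullet> (v + s *\<^sub>R w) \<le> m * ((v + s *\<^sub>R w) \<bullet> (v + s *\<^sub>R w))"
        using vv w S by (intro le) (auto intro: subspace_add subspace_scale)
      moreover have "T w \<bullet> v = c" using sym[of w v] by (simp add: c_def inner_commute)
      ultimately have "m + 2 * s * c + s\<^sup>2 * (T w \<bullet> w) \<le> m * (1 + s\<^sup>2 * (w \<bullet> w))"
        using w vv by (simp add: linear_add[OF T] linear_scale[OF T] inner_simps inner_commute[of w v]
            m_def[symmetric] c_def[symmetric] power2_eq_square algebra_simps)
      then have "2 * s * c \<le> s\<^sup>2 * (m * (w \<bullet> w) - T w \<bullet> w)" by (simp add: algebra_simps)
      also have "\<dots> \<le> s\<^sup>2 * k" by (intro mult_left_mono) (auto simp: k_def)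
      finally show ?thesis .
    qed
    from *[of "c / k"] have "2 * c\<^sup>2 / k \<le> c\<^sup>2 / k"
      using k by (simp add: power2_eq_square field_simps)
    then have "c\<^sup>2 \<le> 0" using k by (simp add: field_simps)
    then show False using nz by (simp add: c_def)
  qed
  let ?w = "T v - m *\<^sub>R v"
  have w: "?w \<in> S" "v \<bullet> ?w = 0"
    using S vv by (auto intro!: subspace_diff subspace_scale simp: inner_diff_right m_def inner_commute)
  have "?w \<bullet> ?w = T v \<bullet> ?w - m * (v \<bullet> ?w)" by (simp only: inner_diff_left inner_scaleR_left)
  also have "\<dots> = 0" by (simp only: orth[OF w] w(2))
  finally have "T v = m *\<^sub>R v" by (simp only: inner_eq_zero_iff right_minus_eq)
  then show thesis using vv that by (auto simp: m_def)
qed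

text \<open>Stated for invariant subspaces so that the induction on the dimension can pass to the
  part of \<open>S\<close> orthogonal to one eigenvector, which \<open>T\<close> preserves by
  symmetry.\<close>

lemma symmetric_diagonalization_subspace:
  fixes T :: "'a::euclidean_space \<Rightarrow> 'a"
  assumes T: "linear T" and sym: "\<And>x y. T x \<bullet> y = x \<bullet> T y"
    and S: "subspace S" "\<And>x. x \<in> S \<Longrightarrow> T x \<in> S"
  shows "\<exists>V. finite V \<and> V \<subseteq> S \<and> (\<forall>u\<in>V. \<forall>v\<in>V. u \<bullet> v = (if u = v then 1 else 0))
     \<and> (\<forall>v\<in>V. T v = (T v \<bullet> v) *\<^sub>R v) \<and> (\<forall>x\<in>S. x = (\<Sum>v\<in>V. (x \<bullet> v) *\<^sub>R v))"
  using S
proof (induction "dim S" arbitrary: S rule: less_induct)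
  case less
  show ?case
  proof (cases "S = {0}")
    case True
    then show ?thesis by (intro exI[of _ "{}"]) auto
  next
    case False
    obtain v where v: "v \<in> S" "norm v = 1" "T v = (T v \<bullet> v) *\<^sub>R v"
      using rayleigh_max_eigenvector[OF T sym less.prems(1) False less.prems(2)] by blast
    have vv: "v \<bullet> v = 1" using v by (simp add: norm_eq_1)
    define S' where "S' = S \<inter> {x. v \<bullet> x = 0}"
    have sub: "subspace S'"
      unfolding S'_def by (intro subspace_inter less.prems subspace_hyperplane)
    have inv: "T x \<in> S'" if "x \<in> S'" for x
    proof -
      have "v \<bullet> T x = T v \<bullet> x" by (rule sym[symmetric])
      also have "\<dots> = (T v \<bullet> v) * (v \<bullet> x)"
        using arg_cong[OF v(3), of "\<lambda>y. y \<bullet> x"] by (simp only: inner_scaleR_left)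
      also have "\<dots> = 0" using that by (simp add: S'_def)
      finally show ?thesis using that less.prems by (auto simp: S'_def)
    qed
    have "v \<notin> S'" using vv by (simp add: S'_def)
    moreover have "S' \<subseteq> S" by (simp add: S'_def)
    ultimately have "S' \<subset> S" using v(1) by blast
    then have "dim S' < dim S"
      using sub less.prems by (metis dim_psubset span_eq_iff)
    from less.hyps[OF this sub inv] obtain V where V: "finite V" "V \<subseteq> S'"
      "\<forall>u\<in>V. \<forall>v\<in>V. u \<bullet> v = (if u = v then 1 else 0)"
      "\<forall>v\<in>V. T v = (T v \<bullet> v) *\<^sub>R v" "\<forall>x\<in>S'. x = (\<Sum>v\<in>V. (x \<bullet> v) *\<^sub>R v)" by blast
    have vV: "v \<notin> V" using V vv by (auto simp: S'_def)
    have o: "v \<bullet> u = 0" "u \<bullet> v = 0" if "u \<in> V" for u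
      using V(2) that by (auto simp: S'_def inner_commute)
    have "x = (\<Sum>u\<in>insert v V. (x \<bullet> u) *\<^sub>R u)" if x: "x \<in> S" for x
    proof -
      have "x - (x \<bullet> v) *\<^sub>R v \<in> S'"
        using x v vv less.prems
        by (auto simp: S'_def inner_simps inner_commute intro: subspace_diff subspace_scale)
      with V(5) have "x - (x \<bullet> v) *\<^sub>R v = (\<Sum>u\<in>V. ((x - (x \<bullet> v) *\<^sub>R v) \<bullet> u) *\<^sub>R u)" by blast
      also have "\<dots> = (\<Sum>u\<in>V. (x \<bullet> u) *\<^sub>R u)"
        by (intro sum.cong) (auto simp: inner_simps o)
      finally show ?thesis using V(1) vV by (simp add: algebra_simps)
    qed
    moreover have "\<forall>u\<in>insert v V. T u = (T u \<bullet> u) *\<^sub>R u"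
      using V(4) v(3) by blast
    moreover have "\<forall>u\<in>insert v V. \<forall>w\<in>insert v V. u \<bullet> w = (if u = w then 1 else 0)"
      using V(3) vV vv o by auto
    ultimately show ?thesis
      using V(1,2) v(1) by (intro exI[of _ "insert v V"]) (auto simp: S'_def)
  qed
qed

text \<open>By the mean value inequality, \<open>G\<close> bounds the difference quotients at all
  times within \<open>\<delta>\<close> of \<open>T\<close>, so dominated convergence applies along
  every sequence tending to \<open>T\<close>.\<close>

lemma has_real_derivative_integral:
  fixes F F' :: "real \<Rightarrow> 'a \<Rightarrow> real"
  assumes T: "\<delta> > 0"
    and int: "\<And>t. \<bar>t - T\<bar> < \<delta> \<Longrightarrow> integrable M (F t)"
    and der: "\<And>t w. \<bar>t - T\<bar> < \<delta> \<Longrightarrow> w \<in> space M \<Longrightarrow> ((\<lambda>t. F t w) has_real_derivative F' t w) (at t)"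
    and bd: "\<And>t w. \<bar>t - T\<bar> < \<delta> \<Longrightarrow> w \<in> space M \<Longrightarrow> \<bar>F' t w\<bar> \<le> G w"
    and G: "integrable M G" and meas: "F' T \<in> borel_measurable M"
  shows "((\<lambda>t. \<integral>w. F t w \<partial>M) has_real_derivative (\<integral>w. F' T w \<partial>M)) (at T)"
  unfolding has_field_derivative_iff tendsto_at_iff_sequentially comp_def
proof safe
  fix X :: "nat \<Rightarrow> real" assume X: "\<forall>i. X i \<in> UNIV - {T}" "X \<longlonglongrightarrow> T"
  have "\<forall>\<^sub>F n in sequentially. \<bar>X n - T\<bar> < \<delta>"
    using X(2) T by (auto simp: tendsto_iff dist_real_def)
  then obtain N where N: "\<And>n. n \<ge> N \<Longrightarrow> \<bar>X n - T\<bar> < \<delta>"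
    by (auto simp: eventually_sequentially)
  have intT: "integrable M (F T)" using int T by auto
  \<comment> \<open>The shift by \<open>N\<close> makes the domination hold at every index;
    \<open>LIMSEQ_offset\<close> removes it afterwards.\<close>
  have "(\<lambda>n. \<integral>w. (F (X (n + N)) w - F T w) / (X (n + N) - T) \<partial>M) \<longlonglongrightarrow> (\<integral>w. F' T w \<partial>M)"
  proof (rule integral_dominated_convergence[where w=G])
    show "AE w in M. (\<lambda>n. (F (X (n + N)) w - F T w) / (X (n + N) - T)) \<longlonglongrightarrow> F' T w"
    proof (rule AE_I2)
      fix w assume w: "w \<in> space M"
      have "((\<lambda>t. F t w) has_real_derivative F' T w) (at T)" using der w T by auto
      then have "(\<lambda>n. (F (X n) w - F T w) / (X n - T)) \<longlonglongrightarrow> F' T w"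
        using X unfolding has_field_derivative_iff tendsto_at_iff_sequentially comp_def by auto
      then show "(\<lambda>n. (F (X (n + N)) w - F T w) / (X (n + N) - T)) \<longlonglongrightarrow> F' T w"
        by (rule LIMSEQ_ignore_initial_segment)
    qed
    show "AE w in M. norm ((F (X (n + N)) w - F T w) / (X (n + N) - T)) \<le> G w" for n
    proof (rule AE_I2)
      fix w assume w: "w \<in> space M"
      have "norm (F (X (n + N)) w - F T w) \<le> G w * norm (X (n + N) - T)"
      proof (rule field_differentiable_bound[where S="ball T \<delta>" and f'="\<lambda>t. F' t w"])
        show "((\<lambda>t. F t w) has_field_derivative F' z w) (at z within ball T \<delta>)" if "z \<in> ball T \<delta>" for z
          using der[of z w] that w by (auto simp: dist_real_def abs_minus_commute intro: has_field_derivative_at_within)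
        show "norm (F' z w) \<le> G w" if "z \<in> ball T \<delta>" for z
          using bd[of z w] that w by (auto simp: dist_real_def abs_minus_commute)
      qed (use N[of "n+N"] T in \<open>auto simp: dist_real_def abs_minus_commute\<close>)
      moreover have "X (n + N) \<noteq> T" using X by auto
      ultimately show "norm ((F (X (n + N)) w - F T w) / (X (n + N) - T)) \<le> G w"
        by (simp add: field_simps)
    qed
    show "(\<lambda>w. (F (X (n + N)) w - F T w) / (X (n + N) - T)) \<in> borel_measurable M" for n
      using int[OF N[of "n + N"]] intT by (auto dest!: borel_measurable_integrable)
  qed (use G meas in auto)
  moreover have "(\<integral>w. (F (X (n + N)) w - F T w) / (X (n + N) - T) \<partial>M)
      = ((\<integral>w. F (X (n + N)) w \<partial>M) - (\<integral>w. F T w \<partial>M)) / (X (n + N) - T)" for n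
    using int[OF N[of "n + N"]] intT by (subst integral_divide_zero) simp
  ultimately have "(\<lambda>n. ((\<integral>w. F (X (n + N)) w \<partial>M) - (\<integral>w. F T w \<partial>M)) / (X (n + N) - T)) \<longlonglongrightarrow> (\<integral>w. F' T w \<partial>M)"
    by (simp only:)
  then show "(\<lambda>n. ((\<integral>w. F (X n) w \<partial>M) - (\<integral>w. F T w \<partial>M)) / (X n - T)) \<longlonglongrightarrow> (\<integral>w. F' T w \<partial>M)"
    by (rule LIMSEQ_offset)
qed

section \<open>Even log-concave functions and Gaussian averages\<close>

lemma log_concaveD:
  assumes "log_concave f" "0 < t" "t < 1"
  shows "f x powr t * f y powr (1 - t) \<le> f (t *\<^sub>R x + (1 - t) *\<^sub>R y)"
  using assms by (auto simp: log_concave_def)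

lemma log_concave_nonneg: "log_concave f \<Longrightarrow> 0 \<le> f x"
  by (auto simp: log_concave_def)

lemma log_concave_mult:
  assumes f: "log_concave f" and g: "log_concave g"
  shows "log_concave (\<lambda>x. f x * g x)"
  unfolding log_concave_def
proof (intro conjI allI impI)
  fix x y and t :: real assume t: "0 < t \<and> t < 1"
  have "(f x * g x) powr t * (f y * g y) powr (1 - t)
      = (f x powr t * f y powr (1 - t)) * (g x powr t * g y powr (1 - t))"
    using log_concave_nonneg[OF f] log_concave_nonneg[OF g] by (simp add: powr_mult mult_ac)
  also have "\<dots> \<le> f (t *\<^sub>R x + (1 - t) *\<^sub>R y) * g (t *\<^sub>R x + (1 - t) *\<^sub>R y)"
    using t by (intro mult_mono log_concaveD f g log_concave_nonneg[OF f]) auto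
  finally show "(f x * g x) powr t * (f y * g y) powr (1 - t)
     \<le> f (t *\<^sub>R x + (1 - t) *\<^sub>R y) * g (t *\<^sub>R x + (1 - t) *\<^sub>R y)" .
qed (simp add: f g log_concave_nonneg)

lemma log_concave_affine:
  assumes f: "log_concave f" and L: "linear L"
  shows "log_concave (\<lambda>x. f (a + L x))"
  unfolding log_concave_def
proof (intro conjI allI impI)
  fix x y and t :: real assume t: "0 < t \<and> t < 1"
  have "L (t *\<^sub>R x + (1 - t) *\<^sub>R y) = t *\<^sub>R L x + (1 - t) *\<^sub>R L y"
    by (simp only: linear_add[OF L] linear_scale[OF L])
  then have "a + L (t *\<^sub>R x + (1 - t) *\<^sub>R y) = t *\<^sub>R (a + L x) + (1 - t) *\<^sub>R (a + L y)"
    by (simp only:) (simp add: algebra_simps)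
  then show "f (a + L x) powr t * f (a + L y) powr (1 - t) \<le> f (a + L (t *\<^sub>R x + (1 - t) *\<^sub>R y))"
    using log_concaveD[OF f, of t "a + L x" "a + L y"] t by simp
qed (use f log_concave_nonneg in auto)

lemma log_concave_std_normal_density: "log_concave std_normal_density"
  unfolding log_concave_def
proof (intro conjI allI impI)
  fix x y t :: real assume t: "0 < t \<and> t < 1"
  define c where "c = 1 / sqrt (2 * pi)"
  have c: "c > 0" by (simp add: c_def)
  have eq: "std_normal_density x = c * exp (- x\<^sup>2 / 2)" for x
    by (simp add: std_normal_density_def c_def)
  have "t * x\<^sup>2 + (1 - t) * y\<^sup>2 - (t * x + (1 - t) * y)\<^sup>2 = t * (1 - t) * (x - y)\<^sup>2"
    by (simp add: power2_eq_square algebra_simps)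
  also have "\<dots> \<ge> 0" using t by simp
  finally have le: "(t * x + (1 - t) * y)\<^sup>2 \<le> t * x\<^sup>2 + (1 - t) * y\<^sup>2" by simp
  have "std_normal_density x powr t * std_normal_density y powr (1 - t)
      = (c powr t * c powr (1 - t)) * (exp (- x\<^sup>2 / 2 * t) * exp (- y\<^sup>2 / 2 * (1 - t)))"
    using c by (simp add: eq powr_mult exp_powr_real mult_ac)
  also have "\<dots> = c * exp (- (t * x\<^sup>2 + (1 - t) * y\<^sup>2) / 2)"
    using c by (simp add: powr_add[symmetric] exp_add[symmetric] field_simps)
  also have "\<dots> \<le> c * exp (- (t * x + (1 - t) * y)\<^sup>2 / 2)"
    using c le by simp
  finally show "std_normal_density x powr t * std_normal_density y powr (1 - t)
      \<le> std_normal_density (t *\<^sub>R x + (1 - t) *\<^sub>R y)"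
    by (simp add: eq)
qed simp

lemma log_concave_superlevel_convex:
  assumes f: "log_concave f" and r: "0 < r"
  shows "convex {x. r < f x}"
proof (rule convexI)
  fix x y and u v :: real
  assume x: "x \<in> {x. r < f x}" and y: "y \<in> {x. r < f x}" and uv: "0 \<le> u" "0 \<le> v" "u + v = 1"
  show "u *\<^sub>R x + v *\<^sub>R y \<in> {x. r < f x}"
  proof (cases "u = 0 \<or> v = 0")
    case False
    then have u: "0 < u" "u < 1" "v = 1 - u" using uv by auto
    have "r = r powr u * r powr (1 - u)"
      using r by (simp add: powr_add[symmetric])
    also have "\<dots> < f x powr u * f y powr (1 - u)"
      using x y r u by (intro mult_strict_mono powr_less_mono2) auto
    also have "\<dots> \<le> f (u *\<^sub>R x + v *\<^sub>R y)"
      using log_concaveD[OF f u(1,2), of x y] u by simp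
    finally show ?thesis by simp
  qed (use x y uv in auto)
qed

text \<open>The Gaussian factor supplies the boundedness required by
  \<open>prekopa_leindler_real\<close>: a log-concave function alone, such as a constant, may have
  unbounded superlevel sets.\<close>

lemma bounded_std_normal_density_superlevel:
  assumes r: "0 < r"
  shows "bounded {s. r < std_normal_density s * K}"
proof (rule boundedI)
  fix s assume "s \<in> {s. r < std_normal_density s * K}"
  then have s: "r < std_normal_density s * K" by simp
  have K: "K > 0"
    using s r by (metis less_trans normal_density_nonneg not_less_iff_gr_or_eq order_less_le
        zero_less_mult_pos mult_zero_left)
  have "std_normal_density s \<le> exp (- s\<^sup>2 / 2)"
    using pi_gt3 by (simp add: std_normal_density_def field_simps real_le_rsqrt)
  also have "\<dots> = 1 / exp (s\<^sup>2 / 2)" by (simp add: exp_minus field_simps)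
  also have "\<dots> \<le> 1 / (1 + s\<^sup>2 / 2)"
    using exp_ge_add_one_self[of "s\<^sup>2 / 2"] by (intro divide_left_mono) (auto intro!: mult_pos_pos add_pos_nonneg)
  finally have "std_normal_density s * K \<le> 1 / (1 + s\<^sup>2 / 2) * K"
    using K by (intro mult_right_mono) auto
  with s have "r < K / (1 + s\<^sup>2 / 2)" by simp
  then have "r * (1 + s\<^sup>2 / 2) < K"
    by (subst (asm) pos_less_divide_eq) (auto intro: add_pos_nonneg)
  then have "r * s\<^sup>2 \<le> 2 * K" using r by (simp add: algebra_simps)
  then have s2: "s\<^sup>2 \<le> 2 * K / r" using r by (simp add: field_simps)
  have "(0::real) \<le> (\<bar>s\<bar> - 1)\<^sup>2" by simp
  then have "2 * \<bar>s\<bar> \<le> 1 + s\<^sup>2" by (simp add: power2_eq_square algebra_simps flip: abs_mult)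
  then show "norm s \<le> 1 + 2 * K / r" using s2 by simp
qed

definition sym_log_concave :: "('a::real_normed_vector \<Rightarrow> real) \<Rightarrow> bool" where
  "sym_log_concave f \<longleftrightarrow> continuous_on UNIV f \<and> log_concave f \<and> (\<forall>x. f (- x) = f x)"

lemma sym_log_concave_measurable [measurable]:
  "sym_log_concave f \<Longrightarrow> f \<in> borel_measurable borel"
  by (auto simp: sym_log_concave_def intro: borel_measurable_continuous_onI)

text \<open>The point \<open>s *\<^sub>R x\<close> lies on the segment from
  \<open>- (r *\<^sub>R x)\<close> to \<open>r *\<^sub>R x\<close>, at whose ends \<open>f\<close>
  takes equal values. In particular \<open>f\<close> is largest at 0.\<close>

lemma sym_log_concave_ray:
  assumes f: "sym_log_concave f" and s: "\<bar>s\<bar> \<le> \<bar>r\<bar>"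
  shows "f (r *\<^sub>R x) \<le> f (s *\<^sub>R x)"
proof -
  have sym: "f (- y) = f y" and nn: "0 \<le> f y" for y
    using f log_concave_nonneg by (auto simp: sym_log_concave_def)
  consider "s = r" | "s = - r" | "\<bar>s\<bar> < \<bar>r\<bar>" using s by linarith
  then show ?thesis
  proof cases
    case 3
    \<comment> \<open>The solution of \<open>s = t * r - (1 - t) * r\<close>.\<close>
    define t where "t = (1 + s / r) / 2"
    have r: "r \<noteq> 0" using 3 by auto
    have "\<bar>s / r\<bar> < 1" using 3 by (simp add: abs_divide)
    then have t: "0 < t" "t < 1" by (auto simp: t_def abs_if split: if_splits)
    have "s = t * r - (1 - t) * r" using r by (simp add: t_def field_simps)
    then have eq: "s *\<^sub>R x = t *\<^sub>R (r *\<^sub>R x) + (1 - t) *\<^sub>R (- (r *\<^sub>R x))"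
      by (simp only: scaleR_scaleR scaleR_minus_right scaleR_left_diff_distrib[of "t * r"] diff_conv_add_uminus[of "_ *\<^sub>R _"])
    have "f (r *\<^sub>R x) = f (r *\<^sub>R x) powr t * f (- (r *\<^sub>R x)) powr (1 - t)"
      using nn[of "r *\<^sub>R x"] by (cases "f (r *\<^sub>R x) = 0") (simp_all add: sym powr_add[symmetric])
    also have "\<dots> \<le> f (s *\<^sub>R x)"
      unfolding eq using f t by (intro log_concaveD) (auto simp: sym_log_concave_def)
    finally show ?thesis .
  qed (auto simp: sym)
qed

lemma sym_log_concave_bounds:
  assumes f: "sym_log_concave f"
  shows "0 \<le> f x" "f x \<le> f 0"
  using f log_concave_nonneg[of f] sym_log_concave_ray[OF f, of 0 1 x] by (auto simp: sym_log_concave_def)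

lemma sym_log_concave_linear:
  fixes L :: "'b::euclidean_space \<Rightarrow> 'a::real_normed_vector"
  assumes f: "sym_log_concave f" and L: "linear L"
  shows "sym_log_concave (\<lambda>x. f (L x))"
proof -
  have "continuous_on UNIV L"
    using L by (simp add: linear_continuous_on linear_conv_bounded_linear)
  then have "continuous_on UNIV (\<lambda>x. f (L x))"
    using f by (intro continuous_on_compose2[of UNIV f UNIV L]) (auto simp: sym_log_concave_def)
  then show ?thesis
    using f log_concave_affine[OF _ L, of f 0] by (auto simp: sym_log_concave_def linear_neg[OF L])
qed

lemma continuous_on_gaussian_integral:
  fixes F :: "'b::metric_space \<Rightarrow> 'a::euclidean_space \<Rightarrow> real"
  assumes c: "\<And>u. continuous_on S (\<lambda>y. F y u)" and m: "\<And>y. F y \<in> borel_measurable borel"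
    and b: "\<And>y u. \<bar>F y u\<bar> \<le> C"
  shows "continuous_on S (\<lambda>y. \<integral>u. F y u \<partial>gaussian)"
  unfolding continuous_on_sequentially
proof (intro allI ballI impI)
  fix X a assume a: "a \<in> S" and X: "(\<forall>n. X n \<in> S) \<and> X \<longlonglongrightarrow> a"
  show "((\<lambda>y. \<integral>u. F y u \<partial>gaussian) \<circ> X) \<longlonglongrightarrow> (\<integral>u. F a u \<partial>gaussian)"
    unfolding comp_def
  proof (rule integral_dominated_convergence[where w="\<lambda>_. C"])
    show "AE x in gaussian. (\<lambda>i. F (X i) x) \<longlonglongrightarrow> F a x"
      using c a X by (intro AE_I2) (auto simp: continuous_on_sequentially comp_def)
  qed (use m b in auto)
qed

lemma integrable_gaussian_bounded:
  fixes F :: "'a::euclidean_space \<Rightarrow> real"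
  assumes "F \<in> borel_measurable borel" "\<And>x. \<bar>F x\<bar> \<le> C"
  shows "integrable gaussian F"
  using assms by (intro gaussian.integrable_const_bound[where B=C]) auto

text \<open>Prekopa's theorem in one direction. Keeping the normal density inside the integrands
  makes them integrable with bounded superlevel sets, and the slices at \<open>x\<close>,
  \<open>y\<close> and their combination satisfy the Prekopa-Leindler hypothesis. Evenness comes
  from reflecting \<open>s\<close>.\<close>

lemma sym_log_concave_gaussian_average:
  fixes k :: "'a::euclidean_space \<Rightarrow> real" and v :: 'a
  assumes k: "sym_log_concave k"
  shows "sym_log_concave (\<lambda>y. \<integral>s. k (y + s *\<^sub>R v) \<partial>(gaussian :: real measure))"
proof -
  have lc: "log_concave k" and cont: "continuous_on UNIV k" and sym: "\<And>x. k (- x) = k x"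
    using k by (auto simp: sym_log_concave_def)
  note bounds = sym_log_concave_bounds[OF k]
  have [measurable]: "k \<in> borel_measurable borel" using k by measurable
  have c: "continuous_on UNIV (\<lambda>y. \<integral>s. k (y + s *\<^sub>R v) \<partial>(gaussian :: real measure))"
    using bounds
    by (intro continuous_on_gaussian_integral[where C="k 0"])
       (auto intro!: continuous_intros continuous_on_compose2[OF cont])
  have dens: "(\<integral>s. k (y + s *\<^sub>R v) \<partial>gaussian) = (\<integral>s. std_normal_density s * k (y + s *\<^sub>R v) \<partial>lborel)"
    "integrable lborel (\<lambda>s. std_normal_density s * k (y + s *\<^sub>R v))" for y
  proof -
    have "integrable (gaussian :: real measure) (\<lambda>s. k (y + s *\<^sub>R v))"
      using bounds by (intro integrable_gaussian_bounded[where C="k 0"]) auto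
    then show "integrable lborel (\<lambda>s. std_normal_density s * k (y + s *\<^sub>R v))"
      by (simp add: gaussian_real_eq integrable_density)
    show "(\<integral>s. k (y + s *\<^sub>R v) \<partial>gaussian) = (\<integral>s. std_normal_density s * k (y + s *\<^sub>R v) \<partial>lborel)"
      by (simp add: gaussian_real_eq integral_density)
  qed
  have lin: "linear (\<lambda>s::real. s *\<^sub>R v)" by (simp add: linear_iff algebra_simps)
  have slice: "log_concave (\<lambda>s. std_normal_density s * k (y + s *\<^sub>R v))" for y
    by (intro log_concave_mult log_concave_std_normal_density log_concave_affine lc lin)
  have lev: "bounded {s. r < std_normal_density s * k (y + s *\<^sub>R v)}" if "r > 0" for r y
  proof (rule bounded_subset[OF bounded_std_normal_density_superlevel[OF that, of "k 0"]], safe)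
    fix s assume "r < std_normal_density s * k (y + s *\<^sub>R v)"
    also have "\<dots> \<le> std_normal_density s * k 0"
      by (intro mult_left_mono bounds) simp
    finally show "r < std_normal_density s * k 0" .
  qed
  have nd1: "std_normal_density s \<le> 1" for s
  proof -
    have "exp (- s\<^sup>2 / 2) \<le> 1" by simp
    moreover have "1 \<le> sqrt (2 * pi)" using pi_gt3 by (simp add: real_le_rsqrt)
    ultimately have "exp (- s\<^sup>2 / 2) \<le> sqrt (2 * pi)" by linarith
    then show ?thesis by (simp add: std_normal_density_def divide_le_eq)
  qed
  have top: "std_normal_density s * k (y + s *\<^sub>R v) \<le> k 0" for s y
    using mult_mono[OF nd1[of s] bounds(2)[of "y + s *\<^sub>R v"]] bounds by simp
  have "log_concave (\<lambda>y. \<integral>s. k (y + s *\<^sub>R v) \<partial>(gaussian :: real measure))"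
    unfolding log_concave_def
  proof (intro conjI allI impI)
    fix x y and t :: real assume t: "0 < t \<and> t < 1"
    show "(\<integral>s. k (x + s *\<^sub>R v) \<partial>gaussian) powr t * (\<integral>s. k (y + s *\<^sub>R v) \<partial>gaussian) powr (1 - t)
        \<le> (\<integral>s. k (t *\<^sub>R x + (1 - t) *\<^sub>R y + s *\<^sub>R v) \<partial>gaussian)"
      unfolding dens(1)
    proof (rule prekopa_leindler_real[where K="k 0"])
      fix a b
      have "(std_normal_density a * k (x + a *\<^sub>R v)) powr t * (std_normal_density b * k (y + b *\<^sub>R v)) powr (1 - t)
         = (std_normal_density a powr t * std_normal_density b powr (1 - t))
           * (k (x + a *\<^sub>R v) powr t * k (y + b *\<^sub>R v) powr (1 - t))"
        using bounds by (simp add: powr_mult mult_ac)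
      also have "\<dots> \<le> std_normal_density (t *\<^sub>R a + (1 - t) *\<^sub>R b)
          * k (t *\<^sub>R (x + a *\<^sub>R v) + (1 - t) *\<^sub>R (y + b *\<^sub>R v))"
        using t by (intro mult_mono log_concaveD log_concave_std_normal_density lc) auto
      also have "t *\<^sub>R (x + a *\<^sub>R v) + (1 - t) *\<^sub>R (y + b *\<^sub>R v) = t *\<^sub>R x + (1 - t) *\<^sub>R y + (t * a + (1 - t) * b) *\<^sub>R v"
        by (simp add: algebra_simps)
      finally show "(std_normal_density a * k (x + a *\<^sub>R v)) powr t * (std_normal_density b * k (y + b *\<^sub>R v)) powr (1 - t)
         \<le> std_normal_density (t * a + (1 - t) * b) * k (t *\<^sub>R x + (1 - t) *\<^sub>R y + (t * a + (1 - t) * b) *\<^sub>R v)"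
        by simp
    qed (use t bounds dens(2) lev top log_concave_superlevel_convex[OF slice] in auto)
  next
    show "0 \<le> (\<integral>s. k (x + s *\<^sub>R v) \<partial>(gaussian :: real measure))" for x
      using bounds by (intro integral_nonneg_AE) auto
  qed
  moreover have "(\<integral>s. k (- y + s *\<^sub>R v) \<partial>(gaussian :: real measure)) = (\<integral>s. k (y + s *\<^sub>R v) \<partial>gaussian)" for y
  proof -
    have "(\<integral>s. k (- y + s *\<^sub>R v) \<partial>(gaussian :: real measure)) = (\<integral>s. k (y + (- s) *\<^sub>R v) \<partial>gaussian)"
      using sym[of "- y + s *\<^sub>R v" for s] by simp
    also have "\<dots> = (\<integral>s. k (y + s *\<^sub>R v) \<partial>gaussian)"
      by (rule integral_gaussian_distr(1)[OF distr_gaussian_uminus, of "\<lambda>s. k (y + s *\<^sub>R v)"]) auto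
    finally show ?thesis .
  qed
  ultimately show ?thesis using c by (simp add: sym_log_concave_def)
qed

text \<open>Induction over the basis vectors: each \<open>b\<close> contributes one average in the
  direction \<open>L b\<close>.\<close>

lemma sym_log_concave_gaussian_convolution:
  fixes k :: "'a::euclidean_space \<Rightarrow> real" and L :: "'b::euclidean_space \<Rightarrow> 'a"
  assumes k: "sym_log_concave k" and L: "linear L"
  shows "sym_log_concave (\<lambda>y. \<integral>u. k (y + L u) \<partial>gaussian)"
proof -
  have [measurable]: "k \<in> borel_measurable borel" "L \<in> borel_measurable borel"
    using k L by (auto intro!: borel_measurable_continuous_onI linear_continuous_on
        linear_conv_bounded_linear[THEN iffD1])
  have "sym_log_concave (\<lambda>y. \<integral>u. k (y + L (\<Sum>b\<in>S. (u \<bullet> b) *\<^sub>R b)) \<partial>(gaussian :: 'b measure))"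
    if "finite S" "S \<subseteq> Basis" for S
    using that
  proof (induction S rule: finite_induct)
    case empty
    then show ?case
      using k gaussian.prob_space[where ?'a='b] by (simp add: linear_0[OF L])
  next
    case (insert b S)
    define Q where "Q = (\<lambda>u::'b. \<Sum>b\<in>S. (u \<bullet> b) *\<^sub>R b)"
    have b: "b \<in> Basis" "norm b = 1" "b \<bullet> b = 1" using insert by auto
    have ortho: "b \<bullet> x = 0" if "x \<in> S" for x
      using that insert b by (metis inner_not_same_Basis insert_subset subsetD)
    \<comment> \<open>\<open>Q\<close> does not see the coordinate along \<open>b\<close>, so
      resampling that coordinate splits it off as an outer integral.\<close>
    have Q: "Q (u - c *\<^sub>R b + s *\<^sub>R b) = Q u" for u c s
      unfolding Q_def using insert b
      by (intro sum.cong) (auto simp: inner_simps ortho)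
    have [measurable]: "Q \<in> borel_measurable borel" by (simp add: Q_def)
    have "(\<integral>u. k (y + L (\<Sum>b\<in>insert b S. (u \<bullet> b) *\<^sub>R b)) \<partial>gaussian)
       = (\<integral>s. \<integral>u. k ((y + s *\<^sub>R L b) + L (Q u)) \<partial>gaussian \<partial>(gaussian :: real measure))" for y
    proof -
      have "(\<integral>u. k (y + L (\<Sum>b\<in>insert b S. (u \<bullet> b) *\<^sub>R b)) \<partial>gaussian)
          = (\<integral>u. k (y + L ((u \<bullet> b) *\<^sub>R b + Q u)) \<partial>gaussian)"
        using insert by (simp add: Q_def)
      also have "\<dots> = (\<integral>s. \<integral>u. k (y + L (((u - (u \<bullet> b) *\<^sub>R b + s *\<^sub>R b) \<bullet> b) *\<^sub>R b + Q (u - (u \<bullet> b) *\<^sub>R b + s *\<^sub>R b)))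
           \<partial>gaussian \<partial>(gaussian :: real measure))"
        using sym_log_concave_bounds[OF k]
        by (intro integral_gaussian_resample b integrable_gaussian_bounded[where C="k 0"]) auto
      finally show ?thesis
        unfolding Q by (simp add: inner_simps b linear_add[OF L] linear_scale[OF L] add_ac)
    qed
    then show ?case
      using sym_log_concave_gaussian_average[OF insert.IH, of "L b"] insert.prems by (simp add: Q_def)
  qed
  from this[OF finite_Basis order_refl] show ?thesis
    by (simp add: euclidean_representation)
qed

text \<open>Reflecting \<open>s\<close> turns twice the integral into that of
  \<open>s * (H (m - s) - H (m + s))\<close>. For nonnegative \<open>s\<close>, \<open>m - s\<close>
  is no farther from 0 than \<open>m + s\<close>, so the difference is nonnegative; for negative
  \<open>s\<close> the roles are exchanged.\<close>

lemma gaussian_first_moment_nonneg: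
  fixes H :: "real \<Rightarrow> real"
  assumes H: "sym_log_concave H" and m: "0 \<le> m"
  shows "0 \<le> (\<integral>s. s * H (m - s) \<partial>gaussian)"
proof -
  have [measurable]: "H \<in> borel_measurable borel" using H by measurable
  note bounds = sym_log_concave_bounds[OF H]
  have i1: "integrable (gaussian :: real measure) (\<lambda>s. s * H (m + c * s))" for c
  proof (rule Bochner_Integration.integrable_bound[where f="\<lambda>s. H 0 * (1 + s\<^sup>2)"])
    show "integrable (gaussian :: real measure) (\<lambda>s. H 0 * (1 + s\<^sup>2))"
      using integrable_gaussian_norm2[where ?'a=real] by auto
    have "\<bar>s\<bar> * \<bar>H (m + c * s)\<bar> \<le> (1 + s\<^sup>2) * H 0" for s
    proof (intro mult_mono)
      have "(0::real) \<le> (\<bar>s\<bar> - 1)\<^sup>2" by simp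
      then have "2 * \<bar>s\<bar> \<le> 1 + s\<^sup>2" by (simp add: power2_eq_square algebra_simps flip: abs_mult)
      then show "\<bar>s\<bar> \<le> 1 + s\<^sup>2" by linarith
    qed (use bounds in auto)
    then show "AE s in gaussian. norm (s * H (m + c * s)) \<le> norm (H 0 * (1 + s\<^sup>2))"
      using bounds by (auto simp: abs_mult mult.commute)
  qed auto
  have "(\<integral>s. s * H (m - s) \<partial>gaussian) = (\<integral>s. (- s) * H (m - (- s)) \<partial>gaussian)"
    by (rule integral_gaussian_distr(1)[OF distr_gaussian_uminus, symmetric]) auto
  then have "2 * (\<integral>s. s * H (m - s) \<partial>gaussian)
      = (\<integral>s. s * H (m + (- 1) * s) \<partial>gaussian) - (\<integral>s. s * H (m + 1 * s) \<partial>gaussian)"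
    by simp
  also have "\<dots> = (\<integral>s. s * H (m + (- 1) * s) - s * H (m + 1 * s) \<partial>gaussian)"
    by (rule Bochner_Integration.integral_diff[symmetric]) (rule i1)+
  also have "\<dots> \<ge> 0"
  proof (rule integral_nonneg_AE, rule AE_I2)
    fix s :: real
    show "0 \<le> s * H (m + (- 1) * s) - s * H (m + 1 * s)"
    proof (cases "s \<ge> 0")
      case True
      then have "H (m + s) \<le> H (m - s)"
        using sym_log_concave_ray[OF H, of "m - s" "m + s" 1] m by simp
      then show ?thesis using True by (simp add: mult_left_mono)
    next
      case False
      then have "H (m - s) \<le> H (m + s)"
        using sym_log_concave_ray[OF H, of "m + s" "m - s" 1] m by simp
      then show ?thesis using False by (simp add: mult_left_mono_neg)
    qed
  qed
  finally show ?thesis by simp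
qed

lemma integrable_gaussian_quadratic_bound:
  fixes G :: "'a::euclidean_space \<Rightarrow> real"
  assumes "G \<in> borel_measurable borel" "\<And>x. \<bar>G x\<bar> \<le> C * (1 + (norm x)\<^sup>2)"
  shows "integrable gaussian G"
proof (rule Bochner_Integration.integrable_bound[where f="\<lambda>x. C * (1 + (norm x)\<^sup>2)"])
  show "integrable gaussian (\<lambda>x::'a. C * (1 + (norm x)\<^sup>2))"
    using integrable_gaussian_norm2[where ?'a='a] by auto
  show "AE x in gaussian. norm (G x) \<le> norm (C * (1 + (norm x)\<^sup>2))"
    using order_trans[OF assms(2) abs_ge_self] by simp
qed (use assms in auto)

text \<open>The shift of \<open>h\<close> and the direction of the linear factor are the same vector
  \<open>a\<close>. Hence both depend on one common coordinate \<open>s\<close>, and what remains is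
  the integral of \<open>s * H (norm a - s)\<close>.\<close>

lemma gaussian_drift_nonneg:
  fixes h :: "'a::euclidean_space \<Rightarrow> real"
  assumes h: "sym_log_concave h"
  shows "0 \<le> (\<integral>u. h (a - u) * (a \<bullet> u) \<partial>gaussian)"
proof (cases "a = 0")
  case False
  define e where "e = (1 / norm a) *\<^sub>R a"
  have "norm e = 1" "a = norm a *\<^sub>R e"
    using False by (simp_all add: e_def)
  then have e: "norm e = 1" "e \<bullet> e = 1" "a = norm a *\<^sub>R e"
    by (simp_all add: norm_eq_1)
  define P where "P = (\<lambda>u. u - (u \<bullet> e) *\<^sub>R e)"
  \<comment> \<open>The orthogonal average is a convolution along the degenerate map
    \<open>- P\<close>, which replaces a Gaussian on the hyperplane; the sign is that of
    \<open>a - u\<close>.\<close>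
  have P: "linear (\<lambda>u. - P u)" by (auto simp: P_def linear_iff inner_simps algebra_simps)
  define H where "H = (\<lambda>r. \<integral>u. h (r *\<^sub>R e + - P u) \<partial>gaussian)"
  have "sym_log_concave (\<lambda>y. \<integral>u. h (y + - P u) \<partial>gaussian)"
    by (rule sym_log_concave_gaussian_convolution[OF h P])
  then have H: "sym_log_concave H"
    unfolding H_def by (rule sym_log_concave_linear) (auto simp: linear_iff algebra_simps)
  have [measurable]: "h \<in> borel_measurable borel" using h by measurable
  have int: "integrable gaussian (\<lambda>u. h (a - u) * (a \<bullet> u))"
  proof (rule integrable_gaussian_quadratic_bound[where C="h 0 * (1 + norm a)"])
    fix u :: 'a
    have "(0::real) \<le> (norm u - 1)\<^sup>2" by simp
    then have "2 * norm u \<le> 1 + (norm u)\<^sup>2" by (simp add: power2_eq_square algebra_simps)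
    then have nu: "norm u \<le> 1 + (norm u)\<^sup>2" using norm_ge_zero[of u] by linarith
    have "\<bar>a \<bullet> u\<bar> \<le> norm a * norm u" by (rule Cauchy_Schwarz_ineq2)
    also have "\<dots> \<le> (1 + norm a) * (1 + (norm u)\<^sup>2)" using nu by (intro mult_mono) auto
    finally have "\<bar>h (a - u)\<bar> * \<bar>a \<bullet> u\<bar> \<le> h 0 * ((1 + norm a) * (1 + (norm u)\<^sup>2))"
      using sym_log_concave_bounds[OF h] by (intro mult_mono) auto
    then show "\<bar>h (a - u) * (a \<bullet> u)\<bar> \<le> h 0 * (1 + norm a) * (1 + (norm u)\<^sup>2)"
      by (simp add: abs_mult mult.assoc)
  qed auto
  have "(\<integral>u. h (a - u) * (a \<bullet> u) \<partial>gaussian)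
     = (\<integral>s. \<integral>u. h (a - (u - (u \<bullet> e) *\<^sub>R e + s *\<^sub>R e)) * (a \<bullet> (u - (u \<bullet> e) *\<^sub>R e + s *\<^sub>R e)) \<partial>gaussian \<partial>(gaussian :: real measure))"
    by (rule integral_gaussian_resample[OF e(1) int])
  also have "\<dots> = (\<integral>s. \<integral>u. norm a * s * h ((norm a - s) *\<^sub>R e + - P u) \<partial>gaussian \<partial>(gaussian :: real measure))"
  proof (intro Bochner_Integration.integral_cong refl)
    fix s u
    have "a \<bullet> (u - (u \<bullet> e) *\<^sub>R e + s *\<^sub>R e) = norm a * (e \<bullet> (u - (u \<bullet> e) *\<^sub>R e + s *\<^sub>R e))"
      by (subst (1) e(3)) (rule inner_scaleR_left)
    also have "e \<bullet> (u - (u \<bullet> e) *\<^sub>R e + s *\<^sub>R e) = s"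
      using e(2) by (simp add: inner_diff_right inner_add_right inner_commute)
    finally have 1: "a \<bullet> (u - (u \<bullet> e) *\<^sub>R e + s *\<^sub>R e) = norm a * s" .
    have 2: "a - (u - (u \<bullet> e) *\<^sub>R e + s *\<^sub>R e) = (norm a - s) *\<^sub>R e + - P u"
      by (subst (1) e(3)) (simp add: P_def algebra_simps)
    show "h (a - (u - (u \<bullet> e) *\<^sub>R e + s *\<^sub>R e)) * (a \<bullet> (u - (u \<bullet> e) *\<^sub>R e + s *\<^sub>R e))
        = norm a * s * h ((norm a - s) *\<^sub>R e + - P u)"
      by (simp only: 1 2) (simp add: mult_ac)
  qed
  also have "\<dots> = norm a * (\<integral>s. s * H (norm a - s) \<partial>gaussian)"
    by (simp add: H_def mult.assoc)
  also have "\<dots> \<ge> 0"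
    using gaussian_first_moment_nonneg[OF H, of "norm a"] by simp
  finally show ?thesis .
qed simp

section \<open>The interpolation\<close>

text \<open>The eigenvectors of \<open>\<Sigma>\<close> are in general not the vectors of
  \<open>Basis\<close>. Completeness is encoded as the expansion identity, the form in which the
  diagonalization delivers it.\<close>

locale orthonormal_frame =
  fixes V :: "'a::euclidean_space set"
  assumes finite_frame: "finite V"
    and orthonormal: "\<And>u v. u \<in> V \<Longrightarrow> v \<in> V \<Longrightarrow> u \<bullet> v = (if u = v then 1 else 0)"
    and expansion: "\<And>x. x = (\<Sum>v\<in>V. (x \<bullet> v) *\<^sub>R v)"
begin

text \<open>The operator with eigenvalue \<open>c v\<close> on \<open>v\<close>; the functions of
  \<open>\<Sigma>\<close> in the argument, such as A(t) and B(t), have this form.\<close>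

definition diag :: "('a \<Rightarrow> real) \<Rightarrow> 'a \<Rightarrow> 'a" where
  "diag c x = (\<Sum>v\<in>V. (c v * (x \<bullet> v)) *\<^sub>R v)"

lemma diag_inner: "v \<in> V \<Longrightarrow> diag c x \<bullet> v = c v * (x \<bullet> v)"
  using finite_frame by (simp add: diag_def inner_sum_left orthonormal if_distrib cong: if_cong)

lemma frame_eqI: "(\<And>v. v \<in> V \<Longrightarrow> x \<bullet> v = y \<bullet> v) \<Longrightarrow> x = y"
  by (subst expansion, subst (2) expansion) (simp cong: sum.cong)

lemma inner_frame: "x \<bullet> y = (\<Sum>v\<in>V. (x \<bullet> v) * (y \<bullet> v))"
  by (subst (2) expansion) (simp add: inner_sum_right mult.commute)

lemma norm2_frame: "(norm x)\<^sup>2 = (\<Sum>v\<in>V. (x \<bullet> v)\<^sup>2)"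
  unfolding power2_norm_eq_inner by (subst inner_frame) (simp add: power2_eq_square)

lemma linear_diag: "linear (diag c)"
  by (auto simp: linear_iff diag_def inner_simps algebra_simps sum.distrib scaleR_sum_right)

lemma continuous_on_diag [continuous_intros]:
  "continuous_on S g \<Longrightarrow> continuous_on S (\<lambda>w. diag c (g w))"
  unfolding diag_def by (intro continuous_intros)

lemma diag_diff: "diag c (x - y) = diag c x - diag c y"
  by (rule linear_diff[OF linear_diag])

text \<open>When \<open>c v\<close> and \<open>s v\<close> are a cosine and a sine, this rotates
  each plane spanned by \<open>(v, 0)\<close> and \<open>(0, v)\<close> separately.\<close>

definition rot :: "('a \<Rightarrow> real) \<Rightarrow> ('a \<Rightarrow> real) \<Rightarrow> 'a \<times> 'a \<Rightarrow> 'a \<times> 'a" where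
  "rot c s w = (diag c (fst w) + diag s (snd w), diag c (snd w) - diag s (fst w))"

lemma continuous_on_rot: "continuous_on UNIV (rot c s)"
  unfolding rot_def by (intro continuous_intros)

lemma norm_rot:
  assumes cs: "\<And>v. v \<in> V \<Longrightarrow> (c v)\<^sup>2 + (s v)\<^sup>2 = 1"
  shows "norm (rot c s w) = norm w"
proof -
  have "(norm (fst (rot c s w)))\<^sup>2 + (norm (snd (rot c s w)))\<^sup>2 = (norm (fst w))\<^sup>2 + (norm (snd w))\<^sup>2"
    unfolding norm2_frame sum.distrib[symmetric]
  proof (intro sum.cong refl)
    fix v assume v: "v \<in> V"
    have "(fst (rot c s w) \<bullet> v)\<^sup>2 + (snd (rot c s w) \<bullet> v)\<^sup>2
        = ((c v)\<^sup>2 + (s v)\<^sup>2) * ((fst w \<bullet> v)\<^sup>2 + (snd w \<bullet> v)\<^sup>2)"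
      using v by (simp add: rot_def inner_simps diag_inner power2_eq_square algebra_simps)
    then show "(fst (rot c s w) \<bullet> v)\<^sup>2 + (snd (rot c s w) \<bullet> v)\<^sup>2 = (fst w \<bullet> v)\<^sup>2 + (snd w \<bullet> v)\<^sup>2"
      using cs[OF v] by simp
  qed
  then show ?thesis by (simp add: norm_prod_def)
qed

text \<open>The outer shears have slope \<open>(1 - c v) / s v\<close>, the tangent of half the
  angle, whence the condition on the sines; the interpolation meets it at positive times.\<close>

lemma distr_gaussian_rot:
  assumes cs: "\<And>v. v \<in> V \<Longrightarrow> (c v)\<^sup>2 + (s v)\<^sup>2 = 1" and s: "\<And>v. v \<in> V \<Longrightarrow> s v \<noteq> 0"
  shows "distr gaussian borel (rot c s) = gaussian"
proof (rule distr_gaussian_rotation[where T="diag (\<lambda>v. (1 - c v) / s v)" and S="diag s"])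
  show "rot c s (x, z) = (let x1 = x + diag (\<lambda>v. (1 - c v) / s v) z; z1 = z - diag s x1
      in (x1 + diag (\<lambda>v. (1 - c v) / s v) z1, z1))" for x z
    unfolding Let_def rot_def fst_conv snd_conv prod.inject
  proof (intro conjI frame_eqI)
    fix v assume v: "v \<in> V"
    define T where "T = (1 - c v) / s v"
    have T: "s v * T = 1 - c v" "T * (1 + c v) = s v"
    proof -
      have "T * (1 + c v) * s v = (1 - c v) * (1 + c v)" using s[OF v] by (simp add: T_def)
      also have "\<dots> = s v * s v" using cs[OF v] by (simp add: power2_eq_square algebra_simps)
      finally show "T * (1 + c v) = s v" using s[OF v] by simp
    qed (use s[OF v] in \<open>simp add: T_def\<close>)
    have 1: "s v * (x \<bullet> v + T * (z \<bullet> v)) = s v * (x \<bullet> v) + (1 - c v) * (z \<bullet> v)"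
      by (simp add: T(1)[symmetric] algebra_simps)
    then show "(diag c z - diag s x) \<bullet> v = (z - diag s (x + diag (\<lambda>v. (1 - c v) / s v) z)) \<bullet> v"
      using v by (simp add: inner_diff_left inner_add_left diag_inner T_def[symmetric]) (simp add: algebra_simps)
    have "x \<bullet> v + T * (z \<bullet> v) + T * (z \<bullet> v - s v * (x \<bullet> v + T * (z \<bullet> v)))
        = x \<bullet> v * (1 - s v * T) + (T * (1 + c v)) * (z \<bullet> v)"
      unfolding 1 by (simp add: algebra_simps)
    also have "\<dots> = c v * (x \<bullet> v) + s v * (z \<bullet> v)"
      by (simp add: T)
    finally show "(diag c x + diag s z) \<bullet> v = (x + diag (\<lambda>v. (1 - c v) / s v) z
        + diag (\<lambda>v. (1 - c v) / s v) (z - diag s (x + diag (\<lambda>v. (1 - c v) / s v) z))) \<bullet> v"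
      using v by (simp add: inner_diff_left inner_add_left diag_inner T_def[symmetric])
  qed
qed (use norm_rot[OF cs] in \<open>auto intro!: borel_measurable_continuous_onI continuous_intros\<close>)

text \<open>Recovers X from the rotated pair; through this identity \<open>f\<close> depends on both
  rotated variables once the derivative is integrated in them.\<close>

lemma rot_inverse:
  assumes cs: "\<And>v. v \<in> V \<Longrightarrow> (c v)\<^sup>2 + (s v)\<^sup>2 = 1"
  shows "diag c (fst (rot c s w)) - diag s (snd (rot c s w)) = fst w"
proof (rule frame_eqI)
  fix v assume v: "v \<in> V"
  have "(diag c (fst (rot c s w)) - diag s (snd (rot c s w))) \<bullet> v = ((c v)\<^sup>2 + (s v)\<^sup>2) * (fst w \<bullet> v)"
    using v by (simp add: rot_def inner_diff_left inner_add_left diag_inner power2_eq_square algebra_simps)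
  then show "(diag c (fst (rot c s w)) - diag s (snd (rot c s w))) \<bullet> v = fst w \<bullet> v"
    using cs[OF v] by simp
qed

definition quad :: "('a \<Rightarrow> real) \<Rightarrow> 'a \<Rightarrow> real" where
  "quad l y = (\<Sum>v\<in>V. l v * (y \<bullet> v)\<^sup>2)"

lemma quad_nonneg: "(\<And>v. v \<in> V \<Longrightarrow> 0 < l v) \<Longrightarrow> 0 \<le> quad l y"
  unfolding quad_def by (intro sum_nonneg mult_nonneg_nonneg) (auto simp: less_imp_le)

lemma continuous_on_quad [continuous_intros]:
  "continuous_on S g \<Longrightarrow> continuous_on S (\<lambda>w. quad l (g w))"
  unfolding quad_def by (intro continuous_intros)

end

text \<open>\<open>\<psi>\<close> is the smoothed \<open>\<phi>\<close>. Its derivative is two-sided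
  even at 0, because the chain rule is applied where the quadratic form may vanish.\<close>

locale gaussian_interpolation = orthonormal_frame V for V :: "'a::euclidean_space set" +
  fixes l :: "'a \<Rightarrow> real" and f :: "'a \<Rightarrow> real" and \<psi> \<psi>' :: "real \<Rightarrow> real" and C :: real
  assumes l_pos: "\<And>v. v \<in> V \<Longrightarrow> 0 < l v"
    and f: "sym_log_concave f"
    and \<psi>_cont: "continuous_on {0..} \<psi>" and \<psi>_bound: "\<And>r. 0 \<le> r \<Longrightarrow> \<bar>\<psi> r\<bar> \<le> C"
    and \<psi>_deriv: "\<And>r. 0 \<le> r \<Longrightarrow> (\<psi> has_real_derivative \<psi>' r) (at r)"
    and \<psi>'_cont: "continuous_on {0..} \<psi>'"
    and \<psi>'_bound: "\<And>r. 0 \<le> r \<Longrightarrow> - C \<le> \<psi>' r \<and> \<psi>' r \<le> 0"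
begin

definition co :: "real \<Rightarrow> 'a \<Rightarrow> real" where "co t v = exp (- t / l v)"

definition si :: "real \<Rightarrow> 'a \<Rightarrow> real" where "si t v = sqrt (1 - (co t v)\<^sup>2)"

text \<open>Only the argument of \<open>\<psi>\<close> moves with \<open>t\<close>, so
  differentiation in time never touches \<open>f\<close>.\<close>

definition energy :: "real \<Rightarrow> 'a \<times> 'a \<Rightarrow> real" where
  "energy t w = f (fst w) * \<psi> (quad l (fst (rot (co t) (si t) w)))"

text \<open>Here \<open>r\<close> is the pair (Y, W), and the sum is <A B^(-1) Y, W> in
  eigencoordinates.\<close>

definition energy' :: "real \<Rightarrow> 'a \<times> 'a \<Rightarrow> real" where
  "energy' t w = (let r = rot (co t) (si t) w in
     f (fst w) * (\<psi>' (quad l (fst r)) * (2 * (\<Sum>v\<in>V. co t v / si t v * ((fst r \<bullet> v) * (snd r \<bullet> v))))))"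

section \<open>Estimates and the time derivative of the interpolation\<close>

lemma C_nonneg: "0 \<le> C"
  using \<psi>_bound[of 0] by simp

lemma quad_l_nonneg: "0 \<le> quad l y"
  using l_pos by (rule quad_nonneg)

lemma f_bounds: "0 \<le> f x" "f x \<le> f 0"
  using sym_log_concave_bounds[OF f] by auto

lemma co_bounds:
  assumes "v \<in> V" "0 \<le> t"
  shows "0 < co t v" "co t v \<le> 1"
  using assms l_pos[of v] by (auto simp: co_def)

lemma co_si:
  assumes "v \<in> V" "0 \<le> t"
  shows "(co t v)\<^sup>2 + (si t v)\<^sup>2 = 1"
  using co_bounds[OF assms] by (simp add: si_def power_le_one)

lemma si_pos:
  assumes "v \<in> V" "0 < t"
  shows "0 < si t v"
proof -
  have "co t v < 1" using assms l_pos[of v] by (simp add: co_def)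
  then have "(co t v)\<^sup>2 < 1"
    using co_bounds[of v t] assms by (simp add: power_less_one_iff)
  then show ?thesis by (simp add: si_def)
qed

text \<open>Keeps the denominators \<open>si t v\<close> away from 0 for all
  \<open>t \<ge> s\<close>, so that one dominating function serves a whole neighbourhood of
  times.\<close>

lemma si_mono:
  assumes "v \<in> V" "0 \<le> s" "s \<le> t"
  shows "si s v \<le> si t v"
proof -
  have "s / l v \<le> t / l v" using assms l_pos[of v] by (intro divide_right_mono) auto
  then have "co t v \<le> co s v" by (simp add: co_def)
  then have "(co t v)\<^sup>2 \<le> (co s v)\<^sup>2"
    by (rule power_mono) (simp add: co_def)
  then show ?thesis by (simp add: si_def)
qed

lemma continuous_on_fst_f: "continuous_on UNIV (\<lambda>w::'a \<times> 'a. f (fst w))"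
  by (rule continuous_on_compose2[of UNIV f UNIV fst])
     (use f in \<open>auto simp: sym_log_concave_def intro!: continuous_on_fst\<close>)

lemma continuous_on_rot' [continuous_intros]:
  "continuous_on UNIV (\<lambda>w. fst (rot c s w))" "continuous_on UNIV (\<lambda>w. snd (rot c s w))"
  by (intro continuous_intros continuous_on_rot)+

lemma energy_measurable: "energy t \<in> borel_measurable borel" "energy' t \<in> borel_measurable borel"
proof -
  have "continuous_on UNIV (energy t)"
    unfolding energy_def
    by (intro continuous_intros continuous_on_fst_f continuous_on_compose2[OF \<psi>_cont])
       (auto intro: quad_l_nonneg)
  then show "energy t \<in> borel_measurable borel"
    by (rule borel_measurable_continuous_onI)
  have "continuous_on UNIV (energy' t)"
    unfolding energy'_def Let_def
    by (intro continuous_intros continuous_on_fst_f continuous_on_compose2[OF \<psi>'_cont])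
       (auto intro: quad_l_nonneg)
  then show "energy' t \<in> borel_measurable borel"
    by (rule borel_measurable_continuous_onI)
qed

lemma energy_bound: "\<bar>energy t w\<bar> \<le> f 0 * C"
  unfolding energy_def abs_mult using f_bounds C_nonneg
  by (intro mult_mono \<psi>_bound quad_l_nonneg) auto

text \<open>The derivatives of \<open>co\<close> and \<open>si\<close>, namely
  \<open>- co / l\<close> and \<open>co^2 / (l * si)\<close>, both carry \<open>1 / l\<close>, which
  cancels the weight in \<open>quad l\<close>. What is left is \<open>co / si\<close> times the
  product of the coordinates of the two rotated components.\<close>

lemma energy_deriv:
  assumes t: "0 < t"
  shows "((\<lambda>t. energy t w) has_real_derivative energy' t w) (at t)"
proof -
  let ?x = "\<lambda>v. fst w \<bullet> v" and ?z = "\<lambda>v. snd w \<bullet> v"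
  have q: "quad l (fst (rot (co t) (si t) w)) = (\<Sum>v\<in>V. l v * (co t v * ?x v + si t v * ?z v)\<^sup>2)" for t
    unfolding quad_def by (intro sum.cong) (auto simp: rot_def inner_add_left diag_inner)
  have dq: "((\<lambda>t. \<Sum>v\<in>V. l v * (co t v * ?x v + si t v * ?z v)\<^sup>2) has_real_derivative
       (\<Sum>v\<in>V. 2 * (co t v / si t v * ((co t v * ?x v + si t v * ?z v) * (co t v * ?z v - si t v * ?x v))))) (at t)"
  proof (rule DERIV_sum)
    fix v assume v: "v \<in> V"
    have l: "l v > 0" and s: "si t v > 0" using v t l_pos si_pos by auto
    have s1: "1 - (co t v)\<^sup>2 > 0" using s by (simp add: si_def)
    have dc: "((\<lambda>t. co t v) has_real_derivative - (co t v / l v)) (at t)"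
      unfolding co_def using l by (auto intro!: derivative_eq_intros)
    have ds: "((\<lambda>t. si t v) has_real_derivative ((co t v)\<^sup>2 / (l v * si t v))) (at t)"
      unfolding si_def using s1
      by (auto intro!: derivative_eq_intros dc simp: power2_eq_square field_simps)
    have "((\<lambda>t. l v * (co t v * ?x v + si t v * ?z v)\<^sup>2) has_real_derivative
        l v * (2 * (co t v * ?x v + si t v * ?z v) * (- (co t v / l v) * ?x v + (co t v)\<^sup>2 / (l v * si t v) * ?z v))) (at t)"
      by (auto intro!: derivative_eq_intros dc ds)
    also have "l v * (2 * (co t v * ?x v + si t v * ?z v) * (- (co t v / l v) * ?x v + (co t v)\<^sup>2 / (l v * si t v) * ?z v))
        = 2 * (co t v / si t v * ((co t v * ?x v + si t v * ?z v) * (co t v * ?z v - si t v * ?x v)))"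
    proof -
      have "l v * (- (co t v / l v) * ?x v + (co t v)\<^sup>2 / (l v * si t v) * ?z v)
          = co t v / si t v * (co t v * ?z v - si t v * ?x v)"
        using l s by (simp add: field_simps power2_eq_square)
      then have "2 * ((co t v * ?x v + si t v * ?z v) * (l v * (- (co t v / l v) * ?x v + (co t v)\<^sup>2 / (l v * si t v) * ?z v)))
          = 2 * ((co t v * ?x v + si t v * ?z v) * (co t v / si t v * (co t v * ?z v - si t v * ?x v)))"
        by (simp only:)
      then show ?thesis by (simp only: mult_ac)
    qed
    finally show "((\<lambda>t. l v * (co t v * ?x v + si t v * ?z v)\<^sup>2) has_real_derivative
       2 * (co t v / si t v * ((co t v * ?x v + si t v * ?z v) * (co t v * ?z v - si t v * ?x v)))) (at t)" .
  qed
  have "((\<lambda>t. \<psi> (quad l (fst (rot (co t) (si t) w)))) has_real_derivative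
      \<psi>' (quad l (fst (rot (co t) (si t) w)))
      * (\<Sum>v\<in>V. 2 * (co t v / si t v * ((co t v * ?x v + si t v * ?z v) * (co t v * ?z v - si t v * ?x v))))) (at t)"
    unfolding q by (rule DERIV_chain2[OF \<psi>_deriv[OF quad_l_nonneg[of "fst (rot (co t) (si t) w)", unfolded q]] dq])
  moreover have "(\<Sum>v\<in>V. 2 * (co t v / si t v * ((co t v * ?x v + si t v * ?z v) * (co t v * ?z v - si t v * ?x v))))
      = 2 * (\<Sum>v\<in>V. co t v / si t v * ((fst (rot (co t) (si t) w) \<bullet> v) * (snd (rot (co t) (si t) w) \<bullet> v)))"
    unfolding sum_distrib_left
    by (intro sum.cong) (auto simp: rot_def inner_add_left inner_diff_left diag_inner)
  ultimately show ?thesis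
    unfolding energy_def energy'_def Let_def by (auto intro!: DERIV_cmult)
qed

lemma energy'_bound:
  assumes t: "0 < s" "s \<le> t"
  shows "\<bar>energy' t w\<bar> \<le> f 0 * (C * (\<Sum>v\<in>V. 1 / si s v)) * (norm w)\<^sup>2"
proof -
  define r where "r = rot (co t) (si t) w"
  \<comment> \<open>One bound for all the ratios \<open>co t v / si t v\<close>; the sum stands in
    for a maximum.\<close>
  let ?D = "\<Sum>v\<in>V. 1 / si s v"
  have D: "co t v / si t v \<le> ?D" "0 \<le> co t v / si t v" if v: "v \<in> V" for v
  proof -
    have p: "0 < si s v" "si s v \<le> si t v" using v t si_pos si_mono by auto
    have "co t v / si t v \<le> 1 / si s v"
      using p co_bounds[OF v, of t] t by (intro frac_le) auto
    also have "1 / si s v \<le> ?D"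
      using v t finite_frame si_pos by (intro member_le_sum) (auto simp: less_imp_le)
    finally show "co t v / si t v \<le> ?D" .
    show "0 \<le> co t v / si t v" using p co_bounds[OF v, of t] t by auto
  qed
  have D0: "0 \<le> ?D" using t si_pos by (intro sum_nonneg) (auto simp: less_imp_le)
  have "\<bar>2 * (\<Sum>v\<in>V. co t v / si t v * ((fst r \<bullet> v) * (snd r \<bullet> v)))\<bar>
      \<le> 2 * (\<Sum>v\<in>V. \<bar>co t v / si t v * ((fst r \<bullet> v) * (snd r \<bullet> v))\<bar>)"
    unfolding abs_mult[of 2] abs_numeral by (intro mult_left_mono sum_abs) simp
  also have "\<dots> \<le> (\<Sum>v\<in>V. ?D * ((fst r \<bullet> v)\<^sup>2 + (snd r \<bullet> v)\<^sup>2))"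
    unfolding sum_distrib_left
  proof (intro sum_mono)
    fix v assume v: "v \<in> V"
    have "0 \<le> (\<bar>fst r \<bullet> v\<bar> - \<bar>snd r \<bullet> v\<bar>)\<^sup>2" by simp
    then have "2 * \<bar>(fst r \<bullet> v) * (snd r \<bullet> v)\<bar> \<le> (fst r \<bullet> v)\<^sup>2 + (snd r \<bullet> v)\<^sup>2"
      by (simp add: power2_diff abs_mult)
    then have "(co t v / si t v) * (2 * \<bar>(fst r \<bullet> v) * (snd r \<bullet> v)\<bar>) \<le> ?D * ((fst r \<bullet> v)\<^sup>2 + (snd r \<bullet> v)\<^sup>2)"
      using D[OF v] D0 by (intro mult_mono) auto
    then show "2 * \<bar>co t v / si t v * ((fst r \<bullet> v) * (snd r \<bullet> v))\<bar> \<le> ?D * ((fst r \<bullet> v)\<^sup>2 + (snd r \<bullet> v)\<^sup>2)"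
      using D(2)[OF v] by (simp only: abs_mult abs_of_nonneg[OF D(2)[OF v]] mult_ac)
  qed
  also have "\<dots> = ?D * (norm r)\<^sup>2"
    by (simp add: norm_prod_def norm2_frame sum.distrib distrib_left sum_nonneg flip: sum_distrib_left)
  also have "norm r = norm w"
    unfolding r_def using t by (intro norm_rot co_si) auto
  finally have S: "\<bar>2 * (\<Sum>v\<in>V. co t v / si t v * ((fst r \<bullet> v) * (snd r \<bullet> v)))\<bar> \<le> ?D * (norm w)\<^sup>2" .
  have "\<bar>\<psi>' (quad l (fst r))\<bar> \<le> C"
    using \<psi>'_bound[OF quad_l_nonneg] C_nonneg by (auto simp: abs_le_iff) (smt (verit))
  then have "\<bar>energy' t w\<bar> \<le> f 0 * (C * (?D * (norm w)\<^sup>2))"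
    unfolding energy'_def Let_def r_def[symmetric] abs_mult[of "f _"] abs_mult[of "\<psi>' _"]
    using f_bounds S C_nonneg by (intro mult_mono) auto
  then show ?thesis by (simp add: mult.assoc)
qed

lemma integrable_energy':
  assumes t: "0 < t"
  shows "integrable gaussian (energy' t)"
proof (rule integrable_gaussian_quadratic_bound[where C="f 0 * (C * (\<Sum>v\<in>V. 1 / si t v))"])
  fix w
  have "0 \<le> f 0 * (C * (\<Sum>v\<in>V. 1 / si t v))"
    using f_bounds C_nonneg t si_pos by (intro mult_nonneg_nonneg sum_nonneg) (auto simp: less_imp_le)
  then show "\<bar>energy' t w\<bar> \<le> f 0 * (C * (\<Sum>v\<in>V. 1 / si t v)) * (1 + (norm w)\<^sup>2)"
    using energy'_bound[OF t order_refl, of w] by (simp add: distrib_left)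
qed (rule energy_measurable)

text \<open>Rotating the pair of Gaussian vectors exhibits the derivative as an average of drift
  integrals of \<open>f\<close> against the nonpositive factor \<open>\<psi>'\<close>; the weight \<open>l\<close> in \<open>quad l\<close> cancels
  against the speed \<open>1 / l\<close> of the interpolation.\<close>

lemma integral_energy'_nonpos:
  assumes t: "0 < t"
  shows "(\<integral>w. energy' t w \<partial>gaussian) \<le> 0"
proof -
  \<comment> \<open>The derivative as a function of (Y, W); the invariance of the Gaussian lets
    these be integrated as independent variables.\<close>
  define G where "G = (\<lambda>w. f (diag (co t) (fst w) - diag (si t) (snd w))
     * (\<psi>' (quad l (fst w)) * (2 * (\<Sum>v\<in>V. co t v / si t v * ((fst w \<bullet> v) * (snd w \<bullet> v))))))"
  have cs: "(co t v)\<^sup>2 + (si t v)\<^sup>2 = 1" "si t v > 0" if "v \<in> V" for v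
    using that t co_si si_pos by auto
  have cG: "continuous_on UNIV G"
    unfolding G_def
  proof (intro continuous_on_mult)
    show "continuous_on UNIV (\<lambda>w. f (diag (co t) (fst w) - diag (si t) (snd w)))"
      by (rule continuous_on_compose2[of UNIV f UNIV])
         (use f in \<open>auto intro!: continuous_intros simp: sym_log_concave_def\<close>)
    show "continuous_on UNIV (\<lambda>w. \<psi>' (quad l (fst w)))"
      by (rule continuous_on_compose2[OF \<psi>'_cont]) (auto intro!: continuous_intros quad_l_nonneg)
  qed (intro continuous_intros)+
  have dist: "distr gaussian borel (rot (co t) (si t)) = gaussian"
    by (rule distr_gaussian_rot) (use cs(1) in simp, metis cs(2) less_irrefl)
  have GR: "energy' t w = G (rot (co t) (si t) w)" for w
    using rot_inverse[where c="co t" and s="si t" and w=w, OF cs(1)] by (simp add: G_def energy'_def Let_def)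
  have mG: "G \<in> borel_measurable borel" and mR: "rot (co t) (si t) \<in> borel_measurable borel"
    by (auto intro!: borel_measurable_continuous_onI cG continuous_on_rot)
  have "integrable gaussian G"
    using integrable_energy'[OF t] integral_gaussian_distr(2)[OF dist mR mG] by (simp add: GR[abs_def])
  then have iG: "integrable (gaussian \<Otimes>\<^sub>M gaussian) (\<lambda>(y, u). G (y, u))"
    by (simp add: gaussian_prod)
  have "(\<integral>w. energy' t w \<partial>gaussian) = (\<integral>w. G w \<partial>gaussian)"
    using integral_gaussian_distr(1)[OF dist mR mG] by (simp add: GR)
  also have "\<dots> = (\<integral>y. \<integral>u. G (y, u) \<partial>gaussian \<partial>gaussian)"
    using gaussian_pair.integral_fst[OF iG] by (simp add: gaussian_prod)
  also have "\<dots> \<le> 0"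
  proof -
    have "(\<integral>u. G (y, u) \<partial>gaussian) \<le> 0" for y
    proof -
      \<comment> \<open>This \<open>a\<close> solves A y = B a. The argument of \<open>f\<close>
        becomes B (a - u), and \<open>f\<close> composed with B is again symmetric and
        log-concave.\<close>
      define a where "a = diag (\<lambda>v. co t v / si t v) y"
      have ha: "diag (co t) y = diag (si t) a"
      proof (rule frame_eqI)
        fix v assume "v \<in> V"
        then show "diag (co t) y \<bullet> v = diag (si t) a \<bullet> v"
          using cs(2)[of v] by (simp add: a_def diag_inner)
      qed
      have "(\<Sum>v\<in>V. co t v / si t v * ((y \<bullet> v) * (u \<bullet> v))) = a \<bullet> u" for u
        by (subst inner_frame) (auto simp: a_def diag_inner intro!: sum.cong)
      then have "(\<integral>u. G (y, u) \<partial>gaussian)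
          = (\<integral>u. 2 * \<psi>' (quad l y) * (f (diag (si t) (a - u)) * (a \<bullet> u)) \<partial>gaussian)"
        by (intro Bochner_Integration.integral_cong) (simp_all add: G_def ha diag_diff mult_ac)
      also have "\<dots> = 2 * \<psi>' (quad l y) * (\<integral>u. f (diag (si t) (a - u)) * (a \<bullet> u) \<partial>gaussian)"
        by simp
      also have "\<dots> \<le> 0"
        by (rule mult_nonpos_nonneg)
           (use gaussian_drift_nonneg[OF sym_log_concave_linear[OF f linear_diag], of "si t" a]
             \<psi>'_bound[OF quad_l_nonneg[of y]] in auto)
      finally show ?thesis .
    qed
    then have "0 \<le> (\<integral>y. - (\<integral>u. G (y, u) \<partial>gaussian) \<partial>gaussian)"
      by (intro integral_nonneg_AE) auto
    then show ?thesis by simp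
  qed
  finally show ?thesis .
qed

lemma integral_energy_antimono:
  assumes "0 < s" "s \<le> t"
  shows "(\<integral>w. energy t w \<partial>gaussian) \<le> (\<integral>w. energy s w \<partial>gaussian)"
proof (rule DERIV_nonpos_imp_nonincreasing[OF assms(2)])
  fix T assume "s \<le> T" "T \<le> t"
  then have T: "0 < T" using assms by simp
  have "((\<lambda>t. \<integral>w. energy t w \<partial>gaussian) has_real_derivative (\<integral>w. energy' T w \<partial>gaussian)) (at T)"
  \<comment> \<open>Radius \<open>T / 2\<close> keeps the times above \<open>T / 2\<close>, where
    the bound on \<open>energy'\<close> is uniform.\<close>
  proof (rule has_real_derivative_integral[where \<delta>="T / 2"
        and G="\<lambda>w. f 0 * (C * (\<Sum>v\<in>V. 1 / si (T / 2) v)) * (norm w)\<^sup>2"])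
    fix t :: real assume t: "\<bar>t - T\<bar> < T / 2"
    then have t': "0 < T / 2" "T / 2 \<le> t" "0 < t" using T by (auto simp: abs_if split: if_splits)
    show "integrable gaussian (energy t)"
      by (rule integrable_gaussian_bounded[OF energy_measurable(1) energy_bound])
    show "((\<lambda>t. energy t w) has_real_derivative energy' t w) (at t)" for w
      by (rule energy_deriv[OF t'(3)])
    show "\<bar>energy' t w\<bar> \<le> f 0 * (C * (\<Sum>v\<in>V. 1 / si (T / 2) v)) * (norm w)\<^sup>2" for w
      by (rule energy'_bound[OF t'(1,2)])
  qed (use T integrable_gaussian_norm2 energy_measurable in auto)
  then show "\<exists>y. ((\<lambda>t. \<integral>w. energy t w \<partial>gaussian) has_real_derivative y) (at T) \<and> y \<le> 0"
    using integral_energy'_nonpos[OF T] by blast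
qed

text \<open>The limiting cosines \<open>c\<close> are arbitrary so that one statement covers both
  ends: \<open>c = 1\<close> at time 0 and \<open>c = 0\<close> at infinity.\<close>

lemma energy_integral_tendsto:
  assumes c: "\<And>v. v \<in> V \<Longrightarrow> (\<lambda>n. co (X n) v) \<longlonglongrightarrow> c v"
  shows "(\<lambda>n. \<integral>w. energy (X n) w \<partial>gaussian) \<longlonglongrightarrow>
     (\<integral>w. f (fst w) * \<psi> (\<Sum>v\<in>V. l v * (c v * (fst w \<bullet> v) + sqrt (1 - (c v)\<^sup>2) * (snd w \<bullet> v))\<^sup>2) \<partial>gaussian)"
proof (rule integral_dominated_convergence[where w="\<lambda>_. f 0 * C"])
  have cf: "(\<Sum>v\<in>V. l v * (d v * (fst w \<bullet> v) + e v * (snd w \<bullet> v))\<^sup>2) \<ge> 0" for d e :: "'a \<Rightarrow> real" and w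
    using l_pos by (intro sum_nonneg mult_nonneg_nonneg) (auto simp: less_imp_le)
  have "continuous_on UNIV (\<lambda>w. f (fst w) * \<psi> (\<Sum>v\<in>V. l v * (c v * (fst w \<bullet> v) + sqrt (1 - (c v)\<^sup>2) * (snd w \<bullet> v))\<^sup>2))"
    by (intro continuous_intros continuous_on_fst_f continuous_on_compose2[OF \<psi>_cont]) (use cf in auto)
  then show "(\<lambda>w. f (fst w) * \<psi> (\<Sum>v\<in>V. l v * (c v * (fst w \<bullet> v) + sqrt (1 - (c v)\<^sup>2) * (snd w \<bullet> v))\<^sup>2)) \<in> borel_measurable gaussian"
    by (simp add: borel_measurable_continuous_onI)
  show "AE w in gaussian. (\<lambda>n. energy (X n) w) \<longlonglongrightarrow>
     f (fst w) * \<psi> (\<Sum>v\<in>V. l v * (c v * (fst w \<bullet> v) + sqrt (1 - (c v)\<^sup>2) * (snd w \<bullet> v))\<^sup>2)"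
  proof (intro AE_I2 tendsto_mult tendsto_const)
    fix w
    have q: "quad l (fst (rot (co t) (si t) w)) = (\<Sum>v\<in>V. l v * (co t v * (fst w \<bullet> v) + si t v * (snd w \<bullet> v))\<^sup>2)" for t
      unfolding quad_def by (intro sum.cong) (auto simp: rot_def inner_add_left diag_inner)
    have "(\<lambda>n. \<Sum>v\<in>V. l v * (co (X n) v * (fst w \<bullet> v) + si (X n) v * (snd w \<bullet> v))\<^sup>2) \<longlonglongrightarrow>
        (\<Sum>v\<in>V. l v * (c v * (fst w \<bullet> v) + sqrt (1 - (c v)\<^sup>2) * (snd w \<bullet> v))\<^sup>2)"
      unfolding si_def by (intro tendsto_intros c)
    then have "(\<lambda>n. \<psi> (\<Sum>v\<in>V. l v * (co (X n) v * (fst w \<bullet> v) + si (X n) v * (snd w \<bullet> v))\<^sup>2)) \<longlonglongrightarrow>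
        \<psi> (\<Sum>v\<in>V. l v * (c v * (fst w \<bullet> v) + sqrt (1 - (c v)\<^sup>2) * (snd w \<bullet> v))\<^sup>2)"
      by (rule continuous_on_tendsto_compose[OF \<psi>_cont]) (use cf in auto)
    then have "(\<lambda>n. f (fst w) * \<psi> (\<Sum>v\<in>V. l v * (co (X n) v * (fst w \<bullet> v) + si (X n) v * (snd w \<bullet> v))\<^sup>2)) \<longlonglongrightarrow>
        f (fst w) * \<psi> (\<Sum>v\<in>V. l v * (c v * (fst w \<bullet> v) + sqrt (1 - (c v)\<^sup>2) * (snd w \<bullet> v))\<^sup>2)"
      by (intro tendsto_intros)
    then show "(\<lambda>n. energy (X n) w) \<longlonglongrightarrow> f (fst w) * \<psi> (\<Sum>v\<in>V. l v * (c v * (fst w \<bullet> v) + sqrt (1 - (c v)\<^sup>2) * (snd w \<bullet> v))\<^sup>2)"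
      by (simp add: energy_def q)
  qed
qed (use energy_measurable energy_bound in auto)

lemma correlation_smooth:
  "(\<integral>x. f x \<partial>gaussian) * (\<integral>x. \<psi> (quad l x) \<partial>gaussian) \<le> (\<integral>x. f x * \<psi> (quad l x) \<partial>gaussian)"
proof -
  have [measurable]: "f \<in> borel_measurable borel" "(\<lambda>x. \<psi> (quad l x)) \<in> borel_measurable borel"
    using f by (auto intro!: borel_measurable_continuous_onI continuous_on_compose2[OF \<psi>_cont]
        continuous_intros quad_l_nonneg)
  have lim0: "(\<lambda>n. \<integral>w. energy (1 / real (Suc n)) w \<partial>gaussian) \<longlonglongrightarrow> (\<integral>x. f x * \<psi> (quad l x) \<partial>gaussian)"
  proof -
    have "(\<lambda>n. exp (- (1 / real (Suc n)) / l v)) \<longlonglongrightarrow> exp (- 0 / l v)" if "v \<in> V" for v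
      using l_pos[OF that] by (intro tendsto_intros LIMSEQ_Suc[OF lim_1_over_n]) auto
    then have "(\<lambda>n. co (1 / real (Suc n)) v) \<longlonglongrightarrow> 1" if "v \<in> V" for v
      using that by (simp add: co_def)
    from energy_integral_tendsto[where c="\<lambda>_. 1", OF this]
    have "(\<lambda>n. \<integral>w. energy (1 / real (Suc n)) w \<partial>gaussian) \<longlonglongrightarrow> (\<integral>w. f (fst w) * \<psi> (quad l (fst w)) \<partial>(gaussian :: ('a \<times> 'a) measure))"
      by (simp add: quad_def)
    also have "(\<integral>w. f (fst w) * \<psi> (quad l (fst w)) \<partial>(gaussian :: ('a \<times> 'a) measure)) = (\<integral>x. f x * \<psi> (quad l x) \<partial>gaussian)"
      by (rule integral_gaussian_distr(1)[OF distr_gaussian_fst, of "\<lambda>x. f x * \<psi> (quad l x)"])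
         (auto intro!: borel_measurable_continuous_onI continuous_intros)
    finally show ?thesis .
  qed
  have lim1: "(\<lambda>n. \<integral>w. energy (real (Suc n)) w \<partial>gaussian) \<longlonglongrightarrow>
      (\<integral>x. f x \<partial>gaussian) * (\<integral>x. \<psi> (quad l x) \<partial>gaussian)"
  proof -
    have "(\<lambda>n. co (real (Suc n)) v) \<longlonglongrightarrow> 0" if v: "v \<in> V" for v
    proof -
      have "filterlim (\<lambda>n. 1 / l v * real (Suc n)) at_top sequentially"
        using l_pos[OF v]
        by (intro filterlim_tendsto_pos_mult_at_top[OF tendsto_const]
            filterlim_compose[OF filterlim_real_sequentially filterlim_Suc]) auto
      then have "(\<lambda>n. exp (- (1 / l v * real (Suc n)))) \<longlonglongrightarrow> 0"
        by (intro filterlim_compose[OF exp_at_bot] filterlim_compose[OF filterlim_uminus_at_bot_at_top])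
      moreover have "co (real (Suc n)) v = exp (- (1 / l v * real (Suc n)))" for n
        unfolding co_def by (rule arg_cong[where f=exp]) (use l_pos[OF v] in \<open>simp add: field_simps\<close>)
      ultimately show ?thesis by (simp only:)
    qed
    from energy_integral_tendsto[where c="\<lambda>_. 0", OF this]
    have "(\<lambda>n. \<integral>w. energy (real (Suc n)) w \<partial>gaussian) \<longlonglongrightarrow> (\<integral>w. f (fst w) * \<psi> (quad l (snd w)) \<partial>(gaussian :: ('a \<times> 'a) measure))"
      by (simp add: quad_def)
    \<comment> \<open>In the limit \<open>\<psi>\<close> sees only \<open>snd w\<close>, which is
      independent of \<open>fst w\<close>, so the integral factorizes.\<close>
    also have "(\<integral>w. f (fst w) * \<psi> (quad l (snd w)) \<partial>(gaussian :: ('a \<times> 'a) measure)) = (\<integral>x. f x \<partial>gaussian) * (\<integral>x. \<psi> (quad l x) \<partial>gaussian)"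
    proof -
      have i: "integrable (gaussian \<Otimes>\<^sub>M gaussian) (\<lambda>w. f (fst w) * \<psi> (quad l (snd w)))"
      proof (rule gaussian_pair.integrable_const_bound[where B="f 0 * C"])
        show "AE w in gaussian \<Otimes>\<^sub>M gaussian. norm (f (fst w) * \<psi> (quad l (snd w))) \<le> f 0 * C"
          using f_bounds \<psi>_bound quad_l_nonneg C_nonneg by (intro AE_I2) (auto simp: abs_mult intro!: mult_mono)
      qed measurable
      have "(\<integral>w. f (fst w) * \<psi> (quad l (snd w)) \<partial>(gaussian \<Otimes>\<^sub>M gaussian))
          = (\<integral>x. \<integral>y. f x * \<psi> (quad l y) \<partial>gaussian \<partial>gaussian)"
        using gaussian_pair.integral_fst[of "\<lambda>x y. f x * \<psi> (quad l y)"] i by (simp add: case_prod_unfold)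
      then show ?thesis by (simp add: gaussian_prod)
    qed
    finally show ?thesis .
  qed
  show ?thesis
    \<comment> \<open>For each \<open>n\<close> the times \<open>1 / Suc n \<le> Suc n\<close> are
      compared, and both run to their ends together.\<close>
    by (rule LIMSEQ_le[OF lim1 lim0]) (intro exI[of _ 0] allI impI integral_energy_antimono; simp add: field_simps)
qed

end

section \<open>The correlation inequality\<close>

text \<open>Difference quotients of an antiderivative smooth \<open>\<phi>\<close>: their derivative
  is a difference quotient of \<open>\<phi>\<close> itself, hence nonpositive by
  monotonicity.\<close>

lemma (in orthonormal_frame) gaussian_correlation_quad:
  fixes f :: "'a \<Rightarrow> real" and \<phi> :: "real \<Rightarrow> real"
  assumes f: "sym_log_concave f" and l: "\<And>v. v \<in> V \<Longrightarrow> 0 < l v"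
    and \<phi>_cont: "continuous_on {0..} \<phi>"
    and \<phi>_nonneg: "\<And>t. t \<ge> 0 \<Longrightarrow> \<phi> t \<ge> 0"
    and \<phi>_mono: "\<And>s t. 0 \<le> s \<Longrightarrow> s \<le> t \<Longrightarrow> \<phi> t \<le> \<phi> s"
  shows "(\<integral>x. f x \<partial>gaussian) * (\<integral>x. \<phi> (quad l x) \<partial>gaussian) \<le> (\<integral>x. f x * \<phi> (quad l x) \<partial>gaussian)"
proof -
  \<comment> \<open>The constant extension to negative arguments, together with the base point -1 of
    \<open>F\<close>, makes 0 an interior point, so that \<open>F\<close> has a two-sided derivative
    there.\<close>
  define g where "g r = \<phi> (max 0 r)" for r
  have g_cont: "continuous_on A g" for A
    unfolding g_def by (intro continuous_on_compose2[OF \<phi>_cont] continuous_intros) auto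
  have g: "0 \<le> g r" "g r \<le> \<phi> 0" for r
    using \<phi>_nonneg \<phi>_mono by (auto simp: g_def)
  have g_mono: "g t \<le> g s" if "s \<le> t" for s t
    unfolding g_def using that by (intro \<phi>_mono) auto
  define F where "F r = integral {-1..r} g" for r
  have F: "(F has_real_derivative g r) (at r)" if r: "-1 < r" for r
  proof -
    have "((\<lambda>x. integral {-1..x} g) has_real_derivative g r) (at r within {-1..r + 1})"
      using r by (intro integral_has_real_derivative g_cont) auto
    then show ?thesis
      using r by (simp add: F_def[abs_def] at_within_Icc_at)
  qed
  define h where "h n = 1 / real (Suc n)" for n
  have h: "0 < h n" "h n \<le> 1" for n by (auto simp: h_def)
  define \<psi> where "\<psi> n r = (F (r + h n) - F r) / h n" for n r
  define \<psi>' where "\<psi>' n r = (g (r + h n) - g r) / h n" for n r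
  have \<psi>_bound: "\<bar>\<psi> n r\<bar> \<le> \<phi> 0" if r: "0 \<le> r" for n r
  proof -
    have "\<exists>z>r. z < r + h n \<and> F (r + h n) - F r = (r + h n - r) * g z"
      using h[of n] r by (intro MVT2 F) auto
    then obtain z where "F (r + h n) - F r = h n * g z" by auto
    then show ?thesis using h[of n] g[of z] by (simp add: \<psi>_def)
  qed
  have \<psi>_deriv: "(\<psi> n has_real_derivative \<psi>' n r) (at r)" if r: "0 \<le> r" for n r
    unfolding \<psi>_def[abs_def] \<psi>'_def
    using r h[of n]
    by (intro DERIV_cdivide DERIV_diff F
        DERIV_shift[THEN iffD1]) auto
  have \<psi>_cont: "continuous_on {0..} (\<psi> n)" for n
    using \<psi>_deriv by (intro DERIV_continuous_on[where D="\<psi>' n"]) (auto intro: has_field_derivative_at_within)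
  have le: "(\<integral>x. f x \<partial>gaussian) * (\<integral>x. \<psi> n (quad l x) \<partial>gaussian) \<le> (\<integral>x. f x * \<psi> n (quad l x) \<partial>gaussian)" for n
  proof -
    interpret gaussian_interpolation V l f "\<psi> n" "\<psi>' n" "\<phi> 0 / h n"
    proof
      \<comment> \<open>The locale uses one constant for \<open>\<psi> n\<close> and
        \<open>\<psi>' n\<close>; as \<open>h n \<le> 1\<close>, the larger bound, that of the
        derivative, serves for both.\<close>
      have "\<phi> 0 \<le> \<phi> 0 / h n"
        using h[of n] \<phi>_nonneg[of 0] by (simp add: pos_le_divide_eq mult_left_le)
      then show "\<bar>\<psi> n r\<bar> \<le> \<phi> 0 / h n" if "0 \<le> r" for r
        using \<psi>_bound[OF that, of n] by simp
      show "continuous_on {0..} (\<psi>' n)"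
        unfolding \<psi>'_def
        using h[of n] by (intro continuous_intros g_cont continuous_on_compose2[OF g_cont[of UNIV]]) auto
      show "- (\<phi> 0 / h n) \<le> \<psi>' n r \<and> \<psi>' n r \<le> 0" if "0 \<le> r" for r
      proof -
        have "- \<phi> 0 \<le> g (r + h n) - g r" "g (r + h n) - g r \<le> 0"
          using g[of "r + h n"] g[of r] g_mono[of r "r + h n"] h[of n] by auto
        then show ?thesis
          using h[of n] divide_right_mono[of "- \<phi> 0" "g (r + h n) - g r" "h n"]
          by (simp add: \<psi>'_def divide_nonpos_pos)
      qed
    qed (use l f \<psi>_cont \<psi>_deriv in auto)
    show ?thesis by (rule correlation_smooth)
  qed
  have \<psi>_lim: "(\<lambda>n. \<psi> n r) \<longlonglongrightarrow> \<phi> r" if r: "0 \<le> r" for r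
  proof -
    have "(\<lambda>t. (F (r + t) - F r) / t) \<midarrow>0\<rightarrow> g r"
      using F[of r] r by (simp add: DERIV_def)
    moreover have "h \<longlonglongrightarrow> 0"
      unfolding h_def by (rule LIMSEQ_Suc[OF lim_1_over_n])
    then have "filterlim h (at 0) sequentially"
      unfolding filterlim_at using h by (auto simp: less_imp_neq[THEN not_sym])
    ultimately have "(\<lambda>n. (F (r + h n) - F r) / h n) \<longlonglongrightarrow> g r"
      by (rule filterlim_compose)
    then show ?thesis using r by (simp add: \<psi>_def g_def)
  qed
  have q: "0 \<le> quad l x" for x using l by (rule quad_nonneg)
  note fb = sym_log_concave_bounds[OF f]
  have \<phi>0: "0 \<le> \<phi> 0" using \<phi>_nonneg by simp
  have [measurable]: "f \<in> borel_measurable borel" using f by measurable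
  have [measurable]: "(\<lambda>x. \<psi> n (quad l x)) \<in> borel_measurable borel" "(\<lambda>x. \<phi> (quad l x)) \<in> borel_measurable borel" for n
    by (auto intro!: borel_measurable_continuous_onI continuous_on_compose2[OF \<psi>_cont]
        continuous_on_compose2[OF \<phi>_cont] continuous_intros q)
  \<comment> \<open>The domination uses \<open>\<phi> 0\<close>, which is uniform in
    \<open>n\<close>, in contrast to the bound on the derivatives.\<close>
  have "(\<lambda>n. \<integral>x. \<psi> n (quad l x) \<partial>gaussian) \<longlonglongrightarrow> (\<integral>x. \<phi> (quad l x) \<partial>gaussian)"
    by (rule integral_dominated_convergence[where w="\<lambda>_. \<phi> 0"]) (auto intro: \<psi>_lim \<psi>_bound q)
  moreover have "(\<lambda>n. \<integral>x. f x * \<psi> n (quad l x) \<partial>gaussian) \<longlonglongrightarrow> (\<integral>x. f x * \<phi> (quad l x) \<partial>gaussian)"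
    by (rule integral_dominated_convergence[where w="\<lambda>_. f 0 * \<phi> 0"])
       (use fb \<phi>0 in \<open>auto simp: abs_mult intro!: tendsto_mult \<psi>_lim \<psi>_bound q mult_mono\<close>)
  ultimately show ?thesis
    using le by (intro LIMSEQ_le[OF tendsto_mult[OF tendsto_const]]) auto
qed

theorem theorem4p1:
  fixes f :: "real ^ 'n \<Rightarrow> real"
    and \<Sigma> :: "real ^ 'n ^ 'n"
    and \<phi> :: "real \<Rightarrow> real"
  assumes f_cont: "continuous_on UNIV f"
    and f_nonneg: "\<And>x. f x \<ge> 0"
    and f_lc: "log_concave f"
    and f_sym: "\<And>x. f (- x) = f x"
    and \<Sigma>_sym: "transpose \<Sigma> = \<Sigma>"
    and \<Sigma>_pd: "\<And>x. x \<noteq> 0 \<Longrightarrow> (\<Sigma> *v x) \<bullet> x > 0"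
    and \<phi>_cont: "continuous_on {0..} \<phi>"
    and \<phi>_nonneg: "\<And>t. t \<ge> 0 \<Longrightarrow> \<phi> t \<ge> 0"
    and \<phi>_mono: "\<And>s t. 0 \<le> s \<Longrightarrow> s \<le> t \<Longrightarrow> \<phi> t \<le> \<phi> s"
  shows "(\<integral>x. f x * \<phi> ((\<Sigma> *v x) \<bullet> x) \<partial>std_gaussian)
         \<ge> (\<integral>x. f x \<partial>std_gaussian) * (\<integral>x. \<phi> ((\<Sigma> *v x) \<bullet> x) \<partial>std_gaussian)"
proof -
  have lin: "linear ((*v) \<Sigma>)" by (rule matrix_vector_mul_linear)
  have sym: "(\<Sigma> *v x) \<bullet> y = x \<bullet> (\<Sigma> *v y)" for x y
    by (metis \<Sigma>_sym dot_lmul_matrix transpose_matrix_vector)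
  \<comment> \<open>No change of variables follows: \<open>f\<close> and the Gaussian stay as they
    are, and only the quadratic form is rewritten in eigencoordinates.\<close>
  obtain V where V: "finite V" "\<forall>u\<in>V. \<forall>v\<in>V. u \<bullet> v = (if u = v then 1 else 0)"
    "\<forall>v\<in>V. \<Sigma> *v v = ((\<Sigma> *v v) \<bullet> v) *\<^sub>R v" "\<forall>x\<in>UNIV. x = (\<Sum>v\<in>V. (x \<bullet> v) *\<^sub>R v)"
    using symmetric_diagonalization_subspace[OF lin sym subspace_UNIV UNIV_I] by blast
  interpret orthonormal_frame V
    by (unfold_locales; use V in blast)
  define l where "l v = (\<Sigma> *v v) \<bullet> v" for v
  have l: "0 < l v" if "v \<in> V" for v
    unfolding l_def using V(2) that by (intro \<Sigma>_pd) force
  have q: "(\<Sigma> *v x) \<bullet> x = quad l x" for x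
  proof -
    have "(\<Sigma> *v x) \<bullet> v = l v * (x \<bullet> v)" if "v \<in> V" for v
    proof -
      have "\<Sigma> *v v = l v *\<^sub>R v" using V(3) that by (simp add: l_def)
      then show ?thesis by (simp add: sym)
    qed
    then show ?thesis
      by (subst inner_frame) (simp add: quad_def power2_eq_square mult.assoc)
  qed
  have "sym_log_concave f"
    using f_cont f_lc f_sym by (simp add: sym_log_concave_def)
  then show ?thesis
    unfolding std_gaussian_eq_gaussian q
    by (rule gaussian_correlation_quad[OF _ l \<phi>_cont \<phi>_nonneg \<phi>_mono])
qed

end
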